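(* Let $Q\in C([0,b],\mathcal M_2)$. There is a constant $C_Q$, depending on the potential $Q$ but not on $N$, such that the following holds. Suppose that $\{a_n,b_n,c_n,d_n\}_{n=0}^N$ are complex numbers such that for every $x\in[0,b]$ $$\Bigl|-\frac12Q(x)-\sum_{n=0}^N\mathcal N_n(x)\begin{pmatrix}a_n&b_n\\ c_n&d_n\end{pmatrix}\Bigr|<\varepsilon .$$ Then the integral kernel $K$ is approximated by $$K_N(x,t)=\sum_{n=0}^N\bigl(a_n\mathcal O_n^1(x,t)+b_n\mathcal O_n^2(x,t)+c_n\mathcal O_n^3(x,t)+d_n\mathcal O_n^4(x,t)\bigr)$$ in such a way that $$\sup_{(x,t)\in\Omega^+}|K(x,t)-K_N(x,t)|<C_Q\,\varepsilon .$$
   Context: $b>0$; $\mathcal M_2$ is the space of complex $2\times2$ matrices with Frobenius norm $|A|=(\sum|a_{ij}|^2)^{1/2}$; $B=\begin{pmatrix}0&1\\ -1&0\end{pmatrix}$, $Q(x)=\begin{pmatrix}p(x)&q(x)\\ q(x)&-p(x)\end{pmatrix}$ with complex-valued $p,q$; $\mathcal P^{\pm}[A]=\frac12(A\pm BAB)$; $\Omega^+=\{(x,t):0\le x\le b,\ |t|\le x\}$. Integral kernel: $K$ is the kernel of the transmutation operator $TY(x)=Y(x)+\int_{-x}^xK(x,t)Y(t)\,dt$ relating $B\frac d{dx}$ and $B\frac d{dx}+Q$, i.e. the solution on $\Omega^+$ of $BK_x+K_tB=-Q(x)K$, $BK(x,x)-K(x,x)B=-Q(x)$, $BK(x,-x)+K(x,-x)B=0$.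 For $Q$ merely continuous this is understood in the mild sense: $H(\xi,\eta)=K(\xi+\eta,\xi-\eta)$ is the continuous solution on $\{\xi,\eta\ge0,\ \xi+\eta\le b\}$ of $H(\xi,\eta)=\frac12BQ(\xi)+\int_0^\xi BQ(u+\eta)\mathcal P^+[H](u,\eta)du+\int_0^\eta BQ(\xi+v)\mathcal P^-[H](\xi,v)dv$. Formal powers: $(f,g)^T$ is a complex-valued absolutely continuous solution of $g'+pf+qg=0$, $-f'+qf-pg=0$ on $[0,b]$, with $f,g$ non-vanishing on $[0,b]$ and $f(0)g(0)=1$. Put $X^{(0)}(x)=-\int_0^x\frac{p}{f^2}ds$, $Y^{(0)}(x)=1+\int_0^x\frac{p}{g^2}ds$, and for $n\ge0$ $Z^{(n)}(x)=\int_0^x(f^2X^{(n)}+g^2Y^{(n)})ds$, $X^{(n+1)}(x)=-(n+1)\int_0^x\bigl(\frac{p}{f^2}Z^{(n)}+\frac gfY^{(n)}\bigr)ds$, $Y^{(n+1)}(x)=(n+1)\int_0^x\bigl(\frac{p}{g^2}Z^{(n)}+\frac fgX^{(n)}\bigr)ds$. The functions $\widetilde X^{(n)},\widetilde Y^{(n)},\widetilde Z^{(n)}$ are defined by the same recurrences starting with $\widetilde X^{(0)}(x)=1+\int_0^x\frac{p}{f^2}ds$, $\widetilde Y^{(0)}(x)=-\int_0^x\frac{p}{g^2}ds$. Define $\Phi_k=(-1)^{(k+1)/2}f(0)(fX^{(k)},gY^{(k)})^T$ for $k$ odd, $\Phi_k=(-1)^{k/2}g(0)(f\widetilde X^{(k)},g\widetilde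 Y^{(k)})^T$ for $k$ even; $\Psi_k=(-1)^{(k-1)/2}g(0)(f\widetilde X^{(k)},g\widetilde Y^{(k)})^T$ for $k$ odd, $\Psi_k=(-1)^{k/2}f(0)(fX^{(k)},gY^{(k)})^T$ for $k$ even. Generalized wave matrices: for $m\ge0$ (empty sums are $0$) $\mathcal U_{2m-1}(x,t)=\sum_{\text{even }k=0}^m\binom mk\Phi_{m-k}(x)t^k$, $\ \mathcal U_{2m}(x,t)=\sum_{\text{odd }k=1}^m\binom mk\Phi_{m-k}(x)t^k$, $\mathcal V_{2m-1}(x,t)=\sum_{\text{even }k=0}^m\binom mk\Psi_{m-k}(x)t^k$, $\ \mathcal V_{2m}(x,t)=\sum_{\text{odd }k=1}^m\binom mk\Psi_{m-k}(x)t^k$, and (matrices given by their columns) $\mathcal O_m^1=[\,\mathcal U_{2m-1}\ \ -\mathcal V_{2m}\,]$, $\mathcal O_m^2=[\,\mathcal V_{2m}\ \ \mathcal U_{2m-1}\,]$, $\mathcal O_m^3=[\,\mathcal V_{2m-1}\ \ \mathcal U_{2m}\,]$, $\mathcal O_m^4=[\,-\mathcal U_{2m}\ \ \mathcal V_{2m-1}\,]$. Finally $\mathcal N_n(x)=[\,-\mathcal V_{2n}(x,x)+B\,\mathcal U_{2n-1}(x,x)\ \ \ \mathcal U_{2n}(x,x)+B\,\mathcal V_{2n-1}(x,x)\,]$. *)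

theory Defs
  imports "HOL-Analysis.Analysis"
begin

text \<open>
  The space of complex two by two matrices is \<^typ>\<open>complex ^ 2 ^ 2\<close>. Its library norm is the
  square root of the sum of the squared norms of the rows, i.e. the Frobenius norm.
\<close>

definition cscale :: "complex \<Rightarrow> complex ^ 2 ^ 2 \<Rightarrow> complex ^ 2 ^ 2" where
  "cscale c A = (\<chi> i j. c * A $ i $ j)"

definition matrix2 :: "complex \<Rightarrow> complex \<Rightarrow> complex \<Rightarrow> complex \<Rightarrow> complex ^ 2 ^ 2" where
  "matrix2 a b c d = vector [vector [a, b], vector [c, d]]"

text \<open>The library's \<^const>\<open>vector\<close> lists rows, so the matrix with given columns is a transpose.\<close>

definition cols2 :: "complex ^ 2 \<Rightarrow> complex ^ 2 \<Rightarrow> complex ^ 2 ^ 2" where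
  "cols2 u v = transpose (vector [u, v])"

definition matB :: "complex ^ 2 ^ 2" where
  "matB = matrix2 0 1 (- 1) 0"

definition potential :: "(real \<Rightarrow> complex) \<Rightarrow> (real \<Rightarrow> complex) \<Rightarrow> real \<Rightarrow> complex ^ 2 ^ 2" where
  "potential p q x = matrix2 (p x) (q x) (q x) (- p x)"

definition Pplus :: "complex ^ 2 ^ 2 \<Rightarrow> complex ^ 2 ^ 2" where
  "Pplus A = (1 / 2) *\<^sub>R (A + matB ** A ** matB)"

definition Pminus :: "complex ^ 2 ^ 2 \<Rightarrow> complex ^ 2 ^ 2" where
  "Pminus A = (1 / 2) *\<^sub>R (A - matB ** A ** matB)"

definition Omega :: "real \<Rightarrow> (real \<times> real) set" where
  "Omega b = {(x, t). 0 \<le> x \<and> x \<le> b \<and> \<bar>t\<bar> \<le> x}"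

definition char_triangle :: "real \<Rightarrow> (real \<times> real) set" where
  "char_triangle b = {(\<xi>, \<eta>). 0 \<le> \<xi> \<and> 0 \<le> \<eta> \<and> \<xi> + \<eta> \<le> b}"

text \<open>
  \<open>K\<close> is the integral kernel of the transmutation operator
  \<open>T Y x = Y x + integral {- x..x} (\<lambda>t. K x t *v Y t)\<close>: the solution on \<^term>\<open>Omega b\<close> of the
  Goursat problem \<open>B K\<^sub>x + K\<^sub>t B = - Q K\<close>, \<open>B K(x,x) - K(x,x) B = - Q x\<close>,
  \<open>B K(x,-x) + K(x,-x) B = 0\<close>. As \<open>Q\<close> is only continuous, the problem is taken in the mild
  sense, in the characteristic coordinates \<open>x = \<xi> + \<eta>\<close>, \<open>t = \<xi> - \<eta>\<close>, which map
  \<^term>\<open>char_triangle b\<close> onto \<^term>\<open>Omega b\<close>.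
\<close>

definition integral_kernel ::
  "real \<Rightarrow> (real \<Rightarrow> complex ^ 2 ^ 2) \<Rightarrow> (real \<Rightarrow> real \<Rightarrow> complex ^ 2 ^ 2) \<Rightarrow> bool" where
  "integral_kernel b Q K \<longleftrightarrow>
     (let H = (\<lambda>\<xi> \<eta>. K (\<xi> + \<eta>) (\<xi> - \<eta>)) in
       continuous_on (char_triangle b) (\<lambda>(\<xi>, \<eta>). H \<xi> \<eta>) \<and>
       (\<forall>(\<xi>, \<eta>) \<in> char_triangle b.
          H \<xi> \<eta> = (1 / 2) *\<^sub>R (matB ** Q \<xi>)
            + integral {0..\<xi>} (\<lambda>u. matB ** Q (u + \<eta>) ** Pplus (H u \<eta>))
            + integral {0..\<eta>} (\<lambda>v. matB ** Q (\<xi> + v) ** Pminus (H \<xi> v))))"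

definition absolutely_continuous_fun :: "real \<Rightarrow> real \<Rightarrow> (real \<Rightarrow> complex) \<Rightarrow> bool" where
  "absolutely_continuous_fun a b f \<longleftrightarrow>
     (\<forall>\<epsilon>>0. \<exists>\<delta>>0. \<forall>(n::nat) (u :: nat \<Rightarrow> real) (v :: nat \<Rightarrow> real).
        (\<forall>i<n. a \<le> u i \<and> u i \<le> v i \<and> v i \<le> b) \<longrightarrow>
        disjoint_family_on (\<lambda>i. {u i<..<v i}) {..<n} \<longrightarrow>
        (\<Sum>i<n. v i - u i) < \<delta> \<longrightarrow>
        (\<Sum>i<n. norm (f (v i) - f (u i))) < \<epsilon>)"

text \<open>For an absolutely continuous solution the equations hold at almost every point.\<close>

definition admissible_solution ::
  "real \<Rightarrow> (real \<Rightarrow> complex) \<Rightarrow> (real \<Rightarrow> complex) \<Rightarrow> (real \<Rightarrow> complex) \<Rightarrow> (real \<Rightarrow> complex) \<Rightarrow> bool"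
  where
  "admissible_solution b p q f g \<longleftrightarrow>
     absolutely_continuous_fun 0 b f \<and> absolutely_continuous_fun 0 b g \<and>
     (AE x in lebesgue. x \<in> {0..b} \<longrightarrow>
        (\<exists>f' g'. (f has_vector_derivative f') (at x within {0..b}) \<and>
                 (g has_vector_derivative g') (at x within {0..b}) \<and>
                 g' + p x * f x + q x * g x = 0 \<and>
                 - f' + q x * f x - p x * g x = 0)) \<and>
     (\<forall>x\<in>{0..b}. f x \<noteq> 0 \<and> g x \<noteq> 0) \<and>
     f 0 * g 0 = 1"

definition zfun ::
  "(real \<Rightarrow> complex) \<Rightarrow> (real \<Rightarrow> complex) \<Rightarrow> (real \<Rightarrow> complex) \<Rightarrow> (real \<Rightarrow> complex) \<Rightarrow> real \<Rightarrow> complex"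
  where
  "zfun f g X Y x = integral {0..x} (\<lambda>s. (f s)\<^sup>2 * X s + (g s)\<^sup>2 * Y s)"

text \<open>
  The recurrences for \<open>X\<^sup>(\<^sup>n\<^sup>)\<close>, \<open>Y\<^sup>(\<^sup>n\<^sup>)\<close> with arbitrary starting functions \<open>X0\<close>, \<open>Y0\<close>; the
  function \<open>Z\<^sup>(\<^sup>n\<^sup>)\<close> is \<^const>\<open>zfun\<close> applied to \<open>X\<^sup>(\<^sup>n\<^sup>)\<close> and \<open>Y\<^sup>(\<^sup>n\<^sup>)\<close>.
\<close>

fun xrec and yrec ::
  "(real \<Rightarrow> complex) \<Rightarrow> (real \<Rightarrow> complex) \<Rightarrow> (real \<Rightarrow> complex) \<Rightarrow>
   (real \<Rightarrow> complex) \<Rightarrow> (real \<Rightarrow> complex) \<Rightarrow> nat \<Rightarrow> real \<Rightarrow> complex"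
  where
  "xrec p f g X0 Y0 0 = X0"
| "yrec p f g X0 Y0 0 = Y0"
| "xrec p f g X0 Y0 (Suc n) = (\<lambda>x. - of_nat (n + 1) * integral {0..x} (\<lambda>s.
     p s / (f s)\<^sup>2 * zfun f g (xrec p f g X0 Y0 n) (yrec p f g X0 Y0 n) s
     + g s / f s * yrec p f g X0 Y0 n s))"
| "yrec p f g X0 Y0 (Suc n) = (\<lambda>x. of_nat (n + 1) * integral {0..x} (\<lambda>s.
     p s / (g s)\<^sup>2 * zfun f g (xrec p f g X0 Y0 n) (yrec p f g X0 Y0 n) s
     + f s / g s * xrec p f g X0 Y0 n s))"

context
  fixes p f g :: "real \<Rightarrow> complex"
begin

definition Xpow :: "nat \<Rightarrow> real \<Rightarrow> complex" where
  "Xpow = xrec p f g (\<lambda>x. - integral {0..x} (\<lambda>s. p s / (f s)\<^sup>2))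
                     (\<lambda>x. 1 + integral {0..x} (\<lambda>s. p s / (g s)\<^sup>2))"

definition Ypow :: "nat \<Rightarrow> real \<Rightarrow> complex" where
  "Ypow = yrec p f g (\<lambda>x. - integral {0..x} (\<lambda>s. p s / (f s)\<^sup>2))
                     (\<lambda>x. 1 + integral {0..x} (\<lambda>s. p s / (g s)\<^sup>2))"

definition Xpow_tilde :: "nat \<Rightarrow> real \<Rightarrow> complex" where
  "Xpow_tilde = xrec p f g (\<lambda>x. 1 + integral {0..x} (\<lambda>s. p s / (f s)\<^sup>2))
                           (\<lambda>x. - integral {0..x} (\<lambda>s. p s / (g s)\<^sup>2))"

definition Ypow_tilde :: "nat \<Rightarrow> real \<Rightarrow> complex" where
  "Ypow_tilde = yrec p f g (\<lambda>x. 1 + integral {0..x} (\<lambda>s. p s / (f s)\<^sup>2))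
                           (\<lambda>x. - integral {0..x} (\<lambda>s. p s / (g s)\<^sup>2))"

definition Phi :: "nat \<Rightarrow> real \<Rightarrow> complex ^ 2" where
  "Phi k x = (if odd k
     then ((- 1) ^ ((k + 1) div 2) * f 0) *s vector [f x * Xpow k x, g x * Ypow k x]
     else ((- 1) ^ (k div 2) * g 0) *s vector [f x * Xpow_tilde k x, g x * Ypow_tilde k x])"

definition Psi :: "nat \<Rightarrow> real \<Rightarrow> complex ^ 2" where
  "Psi k x = (if odd k
     then ((- 1) ^ ((k - 1) div 2) * g 0) *s vector [f x * Xpow_tilde k x, g x * Ypow_tilde k x]
     else ((- 1) ^ (k div 2) * f 0) *s vector [f x * Xpow k x, g x * Ypow k x])"

text \<open>
  \<open>U_lo m\<close>, \<open>U_hi m\<close>, \<open>V_lo m\<close>, \<open>V_hi m\<close> stand for \<open>U\<close> and \<open>V\<close> with index \<open>2m - 1\<close> (lo) and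
  \<open>2m\<close> (hi), which avoids the index \<open>-1\<close> that occurs for \<open>m = 0\<close>.
\<close>

definition U_lo :: "nat \<Rightarrow> real \<Rightarrow> real \<Rightarrow> complex ^ 2" where
  "U_lo m x t = (\<Sum>k | k \<le> m \<and> even k. (of_nat (m choose k) * of_real t ^ k) *s Phi (m - k) x)"

definition U_hi :: "nat \<Rightarrow> real \<Rightarrow> real \<Rightarrow> complex ^ 2" where
  "U_hi m x t = (\<Sum>k | k \<le> m \<and> odd k. (of_nat (m choose k) * of_real t ^ k) *s Phi (m - k) x)"

definition V_lo :: "nat \<Rightarrow> real \<Rightarrow> real \<Rightarrow> complex ^ 2" where
  "V_lo m x t = (\<Sum>k | k \<le> m \<and> even k. (of_nat (m choose k) * of_real t ^ k) *s Psi (m - k) x)"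

definition V_hi :: "nat \<Rightarrow> real \<Rightarrow> real \<Rightarrow> complex ^ 2" where
  "V_hi m x t = (\<Sum>k | k \<le> m \<and> odd k. (of_nat (m choose k) * of_real t ^ k) *s Psi (m - k) x)"

definition O1 :: "nat \<Rightarrow> real \<Rightarrow> real \<Rightarrow> complex ^ 2 ^ 2" where
  "O1 m x t = cols2 (U_lo m x t) (- V_hi m x t)"

definition O2 :: "nat \<Rightarrow> real \<Rightarrow> real \<Rightarrow> complex ^ 2 ^ 2" where
  "O2 m x t = cols2 (V_hi m x t) (U_lo m x t)"

definition O3 :: "nat \<Rightarrow> real \<Rightarrow> real \<Rightarrow> complex ^ 2 ^ 2" where
  "O3 m x t = cols2 (V_lo m x t) (U_hi m x t)"

definition O4 :: "nat \<Rightarrow> real \<Rightarrow> real \<Rightarrow> complex ^ 2 ^ 2" where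
  "O4 m x t = cols2 (- U_hi m x t) (V_lo m x t)"

definition trace_matrix :: "nat \<Rightarrow> real \<Rightarrow> complex ^ 2 ^ 2" where
  "trace_matrix n x = cols2 (- V_hi n x x + matB *v U_lo n x x) (U_hi n x x + matB *v V_lo n x x)"

definition approx_kernel ::
  "nat \<Rightarrow> (nat \<Rightarrow> complex) \<Rightarrow> (nat \<Rightarrow> complex) \<Rightarrow> (nat \<Rightarrow> complex) \<Rightarrow> (nat \<Rightarrow> complex) \<Rightarrow>
   real \<Rightarrow> real \<Rightarrow> complex ^ 2 ^ 2"
  where
  "approx_kernel N a b c d x t =
     (\<Sum>n=0..N. cscale (a n) (O1 n x t) + cscale (b n) (O2 n x t)
               + cscale (c n) (O3 n x t) + cscale (d n) (O4 n x t))"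

end

end

theory Submission
  imports Defs
begin

text \<open>
  In the coordinates \<open>x = \<xi> + \<eta>\<close>, \<open>t = \<xi> - \<eta>\<close> the equation \<open>B K\<^sub>x + K\<^sub>t B = - Q K\<close> splits, because
  \<open>Q\<close> anticommutes with \<open>B\<close>, into the system \<open>\<partial>\<^sub>\<xi> P\<^sup>- H = B Q P\<^sup>+ H\<close>, \<open>\<partial>\<^sub>\<eta> P\<^sup>+ H = B Q P\<^sup>- H\<close>.
  A solution is controlled by \<open>P\<^sup>+ H\<close> on \<open>\<eta> = 0\<close> and \<open>P\<^sup>- H\<close> on \<open>\<xi> = 0\<close>. The formal powers satisfy
  \<open>B \<Phi>\<^sub>n' + Q \<Phi>\<^sub>n = - n \<Psi>\<^sub>n\<^sub>-\<^sub>1\<close> and \<open>B \<Psi>\<^sub>n' + Q \<Psi>\<^sub>n = n \<Phi>\<^sub>n\<^sub>-\<^sub>1\<close>, so that the wave matrices are exact solutions.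
  If \<open>M\<close> is the trace sum approximating \<open>- Q / 2\<close>, then \<open>P\<^sup>+ K\<^sub>N = - B P\<^sup>+ M\<close> on \<open>t = x\<close> and, by parity in \<open>t\<close>,
  \<open>P\<^sup>- K\<^sub>N = - B P\<^sup>- M\<close> on \<open>t = - x\<close>. For \<open>K\<close> the same boundary values hold with \<open>- Q / 2\<close> in place of \<open>M\<close>,
  so both boundary errors of \<open>K - K\<^sub>N\<close> are \<open>O(\<epsilon>)\<close>.
\<close>

subsection \<open>The algebra of two by two matrices\<close>

lemmas matrix2_simps = matrix2_def matB_def cols2_def cscale_def Pplus_def Pminus_def transpose_def
  matrix_matrix_mult_def matrix_vector_mult_def sum_2 vec_eq_iff forall_2

lemma scaleR_complex: "r *\<^sub>R (z :: complex) = of_real r * z"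
  by (rule scaleR_conv_of_real)

lemma Pplus_add_Pminus: "Pplus A + Pminus A = A"
  unfolding Pplus_def Pminus_def scaleR_right_distrib[symmetric] by (simp add: scaleR_2[symmetric])

lemma Pplus_matrix2: "Pplus (matrix2 a b c d) = matrix2 ((a - d) / 2) ((b + c) / 2) ((b + c) / 2) ((d - a) / 2)"
  by (simp add: matrix2_simps scaleR_complex field_simps)

lemma Pminus_matrix2: "Pminus (matrix2 a b c d) = matrix2 ((a + d) / 2) ((b - c) / 2) ((c - b) / 2) ((a + d) / 2)"
  by (simp add: matrix2_simps scaleR_complex field_simps)

lemma matrix2_mult: "matrix2 a b c d ** matrix2 a' b' c' d'
   = matrix2 (a * a' + b * c') (a * b' + b * d') (c * a' + d * c') (c * b' + d * d')"
  by (simp add: matrix2_simps)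

lemma matrix2_expand: "A = matrix2 (A$1$1) (A$1$2) (A$2$1) (A$2$2)"
  by (simp add: matrix2_simps)

lemma matrix2_cases: obtains a b c d where "A = matrix2 a b c d"
  using matrix2_expand by blast

lemma matrix2_add: "matrix2 a b c d + matrix2 a' b' c' d' = matrix2 (a + a') (b + b') (c + c') (d + d')"
  by (simp add: matrix2_simps)

lemma matrix2_diff: "matrix2 a b c d - matrix2 a' b' c' d' = matrix2 (a - a') (b - b') (c - c') (d - d')"
  by (simp add: matrix2_simps)

lemma matrix2_uminus: "- matrix2 a b c d = matrix2 (- a) (- b) (- c) (- d)"
  by (simp add: matrix2_simps)

lemma matrix2_scaleR: "r *\<^sub>R matrix2 a b c d = matrix2 (r * a) (r * b) (r * c) (r * d)"
  by (simp add: matrix2_simps scaleR_complex)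

lemma matrix2_cscale: "cscale r (matrix2 a b c d) = matrix2 (r * a) (r * b) (r * c) (r * d)"
  by (simp add: matrix2_simps)

lemma matrix2_eq_iff: "matrix2 a b c d = matrix2 a' b' c' d' \<longleftrightarrow> a = a' \<and> b = b' \<and> c = c' \<and> d = d'"
  by (auto simp: matrix2_simps)

lemmas matrix2_arith = matrix2_mult matrix2_add matrix2_diff matrix2_uminus matrix2_scaleR matrix2_cscale
  Pplus_matrix2 Pminus_matrix2 matB_def potential_def matrix2_eq_iff

text \<open>Since \<open>matB ** matB\<close> is minus the identity, \<open>Pplus\<close> and
  \<open>Pminus\<close> are the projections onto the matrices that anticommute, respectively
  commute, with \<open>matB\<close>. The product \<open>matB ** potential p q x\<close> anticommutes
  with \<open>matB\<close>, so multiplication by it from the left exchanges the two ranges.\<close>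

lemma Pplus_potential_mult: "Pplus (matB ** potential p q x ** A) = matB ** potential p q x ** Pminus A"
  by (cases A rule: matrix2_cases) (simp add: matrix2_arith field_simps)

lemma Pminus_potential_mult: "Pminus (matB ** potential p q x ** A) = matB ** potential p q x ** Pplus A"
  by (cases A rule: matrix2_cases) (simp add: matrix2_arith field_simps)

text \<open>The map A -> BAB is an involution, and the ranges of \<open>Pplus\<close> and
  \<open>Pminus\<close> are its eigenspaces for 1 and -1. This is what eliminates the t derivative
  from the two characteristic equations.\<close>

lemma Pplus_conj: "Pplus (matB ** A ** matB) = Pplus A"
  by (cases A rule: matrix2_cases) (simp add: matrix2_arith field_simps)

lemma Pminus_conj: "Pminus (matB ** A ** matB) = - Pminus A"
  by (cases A rule: matrix2_cases) (simp add: matrix2_arith field_simps)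

lemma Pplus_mult_matB: "Pplus (A ** matB) = Pplus A ** matB"
  by (cases A rule: matrix2_cases) (simp add: matrix2_arith field_simps)

lemma Pminus_mult_matB: "Pminus (A ** matB) = Pminus A ** matB"
  by (cases A rule: matrix2_cases) (simp add: matrix2_arith field_simps)

lemma Pplus_Pplus: "Pplus (Pplus A) = Pplus A"
  by (cases A rule: matrix2_cases) (simp add: matrix2_arith field_simps)

lemma Pminus_Pplus: "Pminus (Pplus A) = 0"
  by (cases A rule: matrix2_cases) (simp add: matrix2_arith field_simps, simp add: matrix2_simps)

lemma Pplus_Pminus: "Pplus (Pminus A) = 0"
  by (cases A rule: matrix2_cases) (simp add: matrix2_arith field_simps, simp add: matrix2_simps)

lemma Pminus_Pminus: "Pminus (Pminus A) = Pminus A"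
  by (cases A rule: matrix2_cases) (simp add: matrix2_arith field_simps)

lemma Pplus_potential: "Pplus (potential p q x) = potential p q x"
  by (simp add: matrix2_arith field_simps)

lemma Pminus_potential: "Pminus (potential p q x) = 0"
  by (simp add: matrix2_arith field_simps, simp add: matrix2_simps)

lemma Pplus_matB_potential: "Pplus (matB ** potential p q x) = matB ** potential p q x"
  by (simp add: matrix2_arith field_simps)

lemma Pminus_matB_potential: "Pminus (matB ** potential p q x) = 0"
  by (simp add: matrix2_arith field_simps, simp add: matrix2_simps)

lemma scaleR_mult_left: "(r *\<^sub>R A) ** B = r *\<^sub>R ((A :: complex^2^2) ** (B :: complex^2^2))"
  by (cases A rule: matrix2_cases; cases B rule: matrix2_cases) (simp add: matrix2_arith scaleR_complex algebra_simps)

lemma scaleR_mult_right: "A ** (r *\<^sub>R B) = r *\<^sub>R ((A :: complex^2^2) ** (B :: complex^2^2))"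
  by (cases A rule: matrix2_cases; cases B rule: matrix2_cases) (simp add: matrix2_arith scaleR_complex algebra_simps)

lemma bounded_bilinear_matrix2_mult: "bounded_bilinear ((**) :: complex^2^2 \<Rightarrow> complex^2^2 \<Rightarrow> complex^2^2)"
  unfolding bilinear_conv_bounded_bilinear[symmetric] bilinear_def
  by (auto intro!: linearI simp: matrix_add_ldistrib scaleR_mult_left scaleR_mult_right)
     (auto simp: matrix2_simps scaleR_complex algebra_simps)

lemma bounded_linear_Pplus: "bounded_linear Pplus"
  unfolding linear_conv_bounded_linear[symmetric]
  by (rule linearI) (auto simp: matrix2_simps scaleR_complex algebra_simps)

lemma bounded_linear_Pminus: "bounded_linear Pminus"
  unfolding linear_conv_bounded_linear[symmetric]
  by (rule linearI) (auto simp: matrix2_simps scaleR_complex algebra_simps)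

lemma bounded_linear_cscale: "bounded_linear (cscale c)"
  unfolding linear_conv_bounded_linear[symmetric]
  by (rule linearI) (auto simp: matrix2_simps scaleR_complex algebra_simps)

lemma has_vector_derivative_matrix2:
  assumes "(a has_vector_derivative a') F" "(b has_vector_derivative b') F"
    "(c has_vector_derivative c') F" "(d has_vector_derivative d') F"
  shows "((\<lambda>x. matrix2 (a x) (b x) (c x) (d x)) has_vector_derivative matrix2 a' b' c' d') F"
proof -
  have bl: "bounded_linear (\<lambda>z. matrix2 z 0 0 0)" "bounded_linear (\<lambda>z. matrix2 0 z 0 0)"
    "bounded_linear (\<lambda>z. matrix2 0 0 z 0)" "bounded_linear (\<lambda>z. matrix2 0 0 0 z)"
    unfolding linear_conv_bounded_linear[symmetric]
    by (auto intro!: linearI simp: matrix2_arith scaleR_complex)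
  note has_vector_derivative_add[OF has_vector_derivative_add[OF has_vector_derivative_add[OF
    bl(1)[THEN bounded_linear.has_vector_derivative, OF assms(1)]
    bl(2)[THEN bounded_linear.has_vector_derivative, OF assms(2)]]
    bl(3)[THEN bounded_linear.has_vector_derivative, OF assms(3)]]
    bl(4)[THEN bounded_linear.has_vector_derivative, OF assms(4)]]
  then show ?thesis by (simp add: matrix2_add)
qed

subsection \<open>Absolutely continuous functions\<close>

lemma absolutely_continuous_funE:
  assumes "absolutely_continuous_fun a b f" "e > 0"
  obtains \<delta> where "\<delta> > 0" "\<And>(n::nat) u v. (\<forall>i<n. a \<le> u i \<and> u i \<le> v i \<and> v i \<le> b) \<Longrightarrow>
        disjoint_family_on (\<lambda>i. {u i<..<v i}) {..<n} \<Longrightarrow> (\<Sum>i<n. v i - u i) < \<delta> \<Longrightarrow>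
        (\<Sum>i<n. norm (f (v i) - f (u i))) < e"
proof -
  have "\<exists>\<delta>>0. \<forall>(n::nat) u v. (\<forall>i<n. a \<le> u i \<and> u i \<le> v i \<and> v i \<le> b) \<longrightarrow>
        disjoint_family_on (\<lambda>i. {u i<..<v i}) {..<n} \<longrightarrow> (\<Sum>i<n. v i - u i) < \<delta> \<longrightarrow>
        (\<Sum>i<n. norm (f (v i) - f (u i))) < e"
    using assms unfolding absolutely_continuous_fun_def by simp
  then obtain \<delta> where "\<delta> > 0" and \<delta>: "\<forall>(n::nat) u v. (\<forall>i<n. a \<le> u i \<and> u i \<le> v i \<and> v i \<le> b) \<longrightarrow>
        disjoint_family_on (\<lambda>i. {u i<..<v i}) {..<n} \<longrightarrow> (\<Sum>i<n. v i - u i) < \<delta> \<longrightarrow>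
        (\<Sum>i<n. norm (f (v i) - f (u i))) < e"
    by (elim exE conjE)
  then show ?thesis by (intro that[of \<delta>]) simp_all
qed

text \<open>A gauge argument. Cells tagged outside \<open>S\<close> are handled by differentiability
  at the tag. Cells tagged in \<open>S\<close> are forced into an open set of measure below the
  \<delta> of absolute continuity, so the increments of \<open>f\<close> over them sum to less than
  half of the tolerance.\<close>

lemma fundamental_theorem_of_calculus_absolutely_continuous:
  fixes f :: "real \<Rightarrow> complex"
  assumes "a \<le> b" and ac: "absolutely_continuous_fun a b f"
    and S: "negligible S"
    and der: "\<And>x. x \<in> {a..b} - S \<Longrightarrow> (f has_vector_derivative f' x) (at x within {a..b})"
  shows "(f' has_integral f b - f a) {a..b}"
proof -
  \<comment> \<open>With the integrand set to 0 on \<open>S\<close>, a cell tagged there contributes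
    only its increment of \<open>f\<close>; the change is undone at the end because \<open>S\<close>
    is negligible.\<close>
  define h where "h x = (if x \<in> S then 0 else f' x)" for x
  have "(h has_integral f b - f a) {a..b}"
    unfolding box_real[symmetric] has_integral
  proof (intro allI impI)
    fix e :: real
    assume "e > 0"
    \<comment> \<open>The added 1 covers \<open>a = b\<close> and keeps the total error of the good
      cells strictly below \<open>e / 2\<close>.\<close>
    define e1 where "e1 = e / 2 / (b - a + 1)"
    have e1: "e1 > 0" "e1 * (b - a) < e / 2"
      using \<open>e > 0\<close> \<open>a \<le> b\<close> by (auto simp: e1_def field_simps)
    obtain \<delta> where "\<delta> > 0" and \<delta>: "\<And>(n::nat) u v. (\<forall>i<n. a \<le> u i \<and> u i \<le> v i \<and> v i \<le> b) \<Longrightarrow>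
        disjoint_family_on (\<lambda>i. {u i<..<v i}) {..<n} \<Longrightarrow> (\<Sum>i<n. v i - u i) < \<delta> \<Longrightarrow>
        (\<Sum>i<n. norm (f (v i) - f (u i))) < e / 2"
      by (rule absolutely_continuous_funE[OF ac half_gt_zero[OF \<open>e > 0\<close>]]) (rule that)
    have "S \<in> sets lebesgue" "emeasure lebesgue S = 0"
      using S by (auto simp: negligible_iff_null_sets)
    then obtain U where "open U" "S \<subseteq> U" and U: "U - S \<in> lmeasurable" "emeasure lebesgue (U - S) < ennreal \<delta>"
      using sets_lebesgue_outer_open \<open>\<delta> > 0\<close> by metis
    have "U = (U - S) \<union> S" using \<open>S \<subseteq> U\<close> by auto
    have Um: "U \<in> lmeasurable" "measure lebesgue U < \<delta>"
    proof -
      have *: "U \<in> lmeasurable"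
        using U(1) S \<open>S \<subseteq> U\<close> by (metis \<open>U = U - S \<union> S\<close> fmeasurable.Un negligible_iff_measure)
      have "measure lebesgue U = measure lebesgue (U - S)"
        using measure_Un_null_set[of "U - S" lebesgue S] U(1) S \<open>U = (U - S) \<union> S\<close>
        by (metis fmeasurableD negligible_iff_null_sets)
      also have "\<dots> < \<delta>"
        using U \<open>\<delta> > 0\<close> by (simp add: emeasure_eq_measure2 ennreal_less_iff)
      finally show "U \<in> lmeasurable" "measure lebesgue U < \<delta>" using * by auto
    qed
    \<comment> \<open>The gauge radius serves two purposes: around points of \<open>S\<close> the
      ball stays inside \<open>U\<close>, and elsewhere the linear approximation has error at most
      \<open>e1\<close> times the distance.\<close>
    have "\<exists>d>0. (x \<in> S \<longrightarrow> ball x d \<subseteq> U) \<and> (x \<in> {a..b} - S \<longrightarrow>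
           (\<forall>y\<in>{a..b}. norm (y-x) < d \<longrightarrow> norm (f y - f x - (y-x) *\<^sub>R f' x) \<le> e1 * norm (y-x)))" for x
    proof (cases "x \<in> S")
      case True
      then show ?thesis using \<open>open U\<close> \<open>S \<subseteq> U\<close> by (meson DiffD2 openE subsetD)
    next
      case False
      show ?thesis
      proof (cases "x \<in> {a..b}")
        case True
        then show ?thesis
          using der[of x] False e1 unfolding has_vector_derivative_def has_derivative_within_alt
          by (auto simp: mult.commute)
      qed (use False in \<open>auto intro: exI[of _ 1]\<close>)
    qed
    then obtain d where d: "\<And>x. d x > 0" "\<And>x. x \<in> S \<Longrightarrow> ball x (d x) \<subseteq> U"
      "\<And>x y. x \<in> {a..b} - S \<Longrightarrow> y \<in> {a..b} \<Longrightarrow> norm (y-x) < d x \<Longrightarrow>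
           norm (f y - f x - (y-x) *\<^sub>R f' x) \<le> e1 * norm (y-x)"
      by metis
    show "\<exists>\<gamma>. gauge \<gamma> \<and> (\<forall>\<D>. \<D> tagged_division_of cbox a b \<and> \<gamma> fine \<D> \<longrightarrow>
             norm ((\<Sum>(x, k)\<in>\<D>. measure lborel k *\<^sub>R h x) - (f b - f a)) < e)"
    proof (intro exI[of _ "\<lambda>x. ball x (d x)"] conjI allI impI)
      show "gauge (\<lambda>x. ball x (d x))"
        using d(1) gauge_ball_dependent by blast
    next
      fix p
      assume "p tagged_division_of cbox a b \<and> (\<lambda>x. ball x (d x)) fine p"
      then have p: "p tagged_division_of {a..b}" and fine: "(\<lambda>x. ball x (d x)) fine p" by auto
      have "finite p" using p by blast
      have cell: "\<exists>u v. K = {u..v} \<and> u \<le> v \<and> a \<le> u \<and> v \<le> b \<and> x \<in> {u..v} \<and> {u..v} \<subseteq> ball x (d x)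
             \<and> Inf K = u \<and> Sup K = v \<and> measure lborel K = v - u"
        if "(x, K) \<in> p" for x K
      proof -
        obtain u v where K: "K = cbox u v" using p \<open>(x, K) \<in> p\<close> by blast
        have "x \<in> K" "K \<subseteq> {a..b}" using p \<open>(x, K) \<in> p\<close> by blast+
        then show ?thesis
          using fineD[OF fine \<open>(x, K) \<in> p\<close>] K by (intro exI[of _ u] exI[of _ v]) auto
      qed
      have ba: "b - a = (\<Sum>(x,K)\<in>p. Sup K - Inf K)" "f b - f a = (\<Sum>(x,K)\<in>p. f(Sup K) - f(Inf K))"
        using additive_tagged_division_1[OF \<open>a \<le> b\<close> p, where f= "\<lambda>x. x"]
          additive_tagged_division_1[OF \<open>a \<le> b\<close> p, where f= f] by auto
      define bad where "bad = {(x, K) \<in> p. x \<in> S}"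
      have "bad \<subseteq> p" by (auto simp: bad_def)
      then have "finite bad" using \<open>finite p\<close> by (rule finite_subset)
      have good: "norm (measure lborel K *\<^sub>R h x - (f (Sup K) - f (Inf K))) \<le> e1 * (Sup K - Inf K)"
        if "(x, K) \<in> p - bad" for x K
      proof -
        have "(x, K) \<in> p" "x \<notin> S" using that by (auto simp: bad_def)
        obtain u v where K: "K = {u..v}" "u \<le> v" "a \<le> u" "v \<le> b" "x \<in> {u..v}" "{u..v} \<subseteq> ball x (d x)"
          "Inf K = u" "Sup K = v" "measure lborel K = v - u"
          using cell[OF \<open>(x, K) \<in> p\<close>] by blast
        have "u \<in> ball x (d x)" "v \<in> ball x (d x)"
          by (rule subsetD[OF K(6)], use K(2) in simp)+
        then have uv: "norm (u - x) < d x" "norm (v - x) < d x"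
          by (auto simp: dist_real_def)
        \<comment> \<open>Both endpoints are compared with the tag \<open>x\<close>. As
          \<open>x\<close> lies between them, the two errors add up to \<open>e1\<close> times the
          length of the cell.\<close>
        have "norm ((v - u) *\<^sub>R f' x - (f v - f u))
             = norm (f u - f x - (u - x) *\<^sub>R f' x - (f v - f x - (v - x) *\<^sub>R f' x))"
          by (rule arg_cong[where f = norm]) (simp add: algebra_simps)
        also have "\<dots> \<le> norm (f u - f x - (u - x) *\<^sub>R f' x) + norm (f v - f x - (v - x) *\<^sub>R f' x)"
          by (rule norm_triangle_ineq4)
        also have "\<dots> \<le> e1 * norm (u - x) + e1 * norm (v - x)"
          using uv K \<open>x \<notin> S\<close> by (intro add_mono d(3)) auto
        also have "\<dots> = e1 * (v - u)" using K by (auto simp: algebra_simps)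
        finally show ?thesis using K \<open>x \<notin> S\<close> by (simp add: h_def)
      qed
      have "norm (\<Sum>(x, K)\<in>p - bad. measure lborel K *\<^sub>R h x - (f (Sup K) - f (Inf K)))
          \<le> (\<Sum>(x, K)\<in>p - bad. e1 * (Sup K - Inf K))"
        by (rule sum_norm_le) (use good in auto)
      also have "\<dots> \<le> (\<Sum>(x, K)\<in>p. e1 * (Sup K - Inf K))"
        by (rule sum_mono2) (use \<open>finite p\<close> cell e1 in \<open>fastforce simp: bad_def\<close>)+
      also have "\<dots> = e1 * (b - a)"
        unfolding ba(1) by (simp add: sum_distrib_left case_prod_unfold)
      finally have goodsum: "norm (\<Sum>(x, K)\<in>p - bad. measure lborel K *\<^sub>R h x - (f (Sup K) - f (Inf K))) < e / 2"
        using e1 by linarith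
      have badsum: "(\<Sum>(x, K)\<in>bad. norm (f (Sup K) - f (Inf K))) < e / 2"
      proof -
        \<comment> \<open>Absolute continuity is stated for intervals numbered by the naturals below
          \<open>n\<close>, so the bad cells are enumerated.\<close>
        obtain c where c: "bij_betw c {..<card bad} bad"
          using ex_bij_betw_nat_finite[OF \<open>finite bad\<close>] by (auto simp: atLeast0LessThan)
        have cin: "c i \<in> bad" if "i < card bad" for i
          using c that by (auto simp: bij_betw_def)
        have eq: "(\<Sum>i<card bad. \<phi> (c i)) = (\<Sum>z\<in>bad. \<phi> z)" for \<phi> :: "real \<times> real set \<Rightarrow> real"
          by (rule sum.reindex_bij_betw[OF c])
        have int: "interior K \<inter> interior K' = {}" if "(x, K) \<in> p" "(x', K') \<in> p" "(x, K) \<noteq> (x', K')" for x x' K K'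
          using p that by (meson tagged_division_ofD(5))
        have iK: "interior K = {Inf K<..<Sup K}" if "(x, K) \<in> p" for x K
          using cell[OF that] by (metis interior_atLeastAtMost_real)
        have disj: "disjoint_family_on (\<lambda>z. {Inf (snd z)<..<Sup (snd z)}) bad"
          unfolding disjoint_family_on_def
        proof (intro ballI impI)
          fix z z' assume "z \<in> bad" "z' \<in> bad" "z \<noteq> z'"
          then show "{Inf (snd z)<..<Sup (snd z)} \<inter> {Inf (snd z')<..<Sup (snd z')} = {}"
            using int[of "fst z" "snd z" "fst z'" "snd z'"] iK[of "fst z" "snd z"] iK[of "fst z'" "snd z'"]
              \<open>bad \<subseteq> p\<close> by auto
        qed
        \<comment> \<open>The open cells are disjoint, so their total length is the measure of their
          union, and that union lies in \<open>U\<close>.\<close>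
        have "(\<Sum>z\<in>bad. Sup (snd z) - Inf (snd z)) = (\<Sum>z\<in>bad. measure lebesgue {Inf (snd z)<..<Sup (snd z)})"
          using cell \<open>bad \<subseteq> p\<close> by (intro sum.cong) fastforce+
        also have "\<dots> = measure lebesgue (\<Union>z\<in>bad. {Inf (snd z)<..<Sup (snd z)})"
          using disj \<open>finite bad\<close> emeasure_lborel_box_finite[of "_ :: real"]
          by (intro measure_finite_Union[symmetric]) (auto simp: less_top)
        also have "\<dots> \<le> measure lebesgue U"
        proof (rule measure_mono_fmeasurable)
          show "(\<Union>z\<in>bad. {Inf (snd z)<..<Sup (snd z)}) \<subseteq> U"
          proof (rule UN_least)
            fix z assume "z \<in> bad"
            then obtain x K where z: "z = (x, K)" "(x, K) \<in> p" "x \<in> S" by (auto simp: bad_def)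
            show "{Inf (snd z)<..<Sup (snd z)} \<subseteq> U"
              using cell[OF z(2)] d(2)[OF z(3)] z by fastforce
          qed
        qed (use Um \<open>finite bad\<close> in auto)
        finally have len: "(\<Sum>z\<in>bad. Sup (snd z) - Inf (snd z)) < \<delta>" using Um by linarith
        have "(\<Sum>i<card bad. norm (f (Sup (snd (c i))) - f (Inf (snd (c i))))) < e / 2"
        proof (rule \<delta>)
          show "\<forall>i<card bad. a \<le> Inf (snd (c i)) \<and> Inf (snd (c i)) \<le> Sup (snd (c i)) \<and> Sup (snd (c i)) \<le> b"
            using cin cell \<open>bad \<subseteq> p\<close> by (metis prod.collapse subsetD)
          show "disjoint_family_on (\<lambda>i. {Inf (snd (c i))<..<Sup (snd (c i))}) {..<card bad}"
            using disj c unfolding disjoint_family_on_def bij_betw_def inj_on_def by blast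
          show "(\<Sum>i<card bad. Sup (snd (c i)) - Inf (snd (c i))) < \<delta>"
            using len eq[of "\<lambda>z. Sup (snd z) - Inf (snd z)"] by simp
        qed
        then show ?thesis
          using eq[of "\<lambda>z. norm (f (Sup (snd z)) - f (Inf (snd z)))"] by (simp add: case_prod_unfold)
      qed
      have "(\<Sum>(x, K)\<in>p. measure lborel K *\<^sub>R h x) - (f b - f a)
          = (\<Sum>(x, K)\<in>p. measure lborel K *\<^sub>R h x - (f (Sup K) - f (Inf K)))"
        unfolding ba(2) by (simp add: case_prod_unfold sum_subtractf)
      also have "\<dots> = (\<Sum>(x, K)\<in>p - bad. measure lborel K *\<^sub>R h x - (f (Sup K) - f (Inf K)))
           + (\<Sum>(x, K)\<in>bad. measure lborel K *\<^sub>R h x - (f (Sup K) - f (Inf K)))"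
        by (rule sum.subset_diff[OF \<open>bad \<subseteq> p\<close> \<open>finite p\<close>])
      also have "norm \<dots> \<le> norm (\<Sum>(x, K)\<in>p - bad. measure lborel K *\<^sub>R h x - (f (Sup K) - f (Inf K)))
           + (\<Sum>(x, K)\<in>bad. norm (f (Sup K) - f (Inf K)))"
        by (intro order.trans[OF norm_triangle_ineq] add_left_mono sum_norm_le)
           (auto simp: bad_def h_def norm_minus_commute)
      finally show "norm ((\<Sum>(x, K)\<in>p. measure lborel K *\<^sub>R h x) - (f b - f a)) < e"
        using goodsum badsum by linarith
    qed
  qed
  then show ?thesis
    by (rule has_integral_spike[OF S, rotated]) (auto simp: h_def)
qed

lemma absolutely_continuous_fun_subinterval:
  assumes "absolutely_continuous_fun a b f" "a \<le> c" "d \<le> b"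
  shows "absolutely_continuous_fun c d f"
  unfolding absolutely_continuous_fun_def
proof (intro allI impI)
  fix e :: real assume "e > 0"
  obtain \<delta> where "\<delta> > 0" and \<delta>: "\<And>(n::nat) u v. (\<forall>i<n. a \<le> u i \<and> u i \<le> v i \<and> v i \<le> b) \<Longrightarrow>
        disjoint_family_on (\<lambda>i. {u i<..<v i}) {..<n} \<Longrightarrow> (\<Sum>i<n. v i - u i) < \<delta> \<Longrightarrow>
        (\<Sum>i<n. norm (f (v i) - f (u i))) < e"
    by (rule absolutely_continuous_funE[OF assms(1) \<open>e > 0\<close>]) (rule that)
  show "\<exists>\<delta>>0. \<forall>(n::nat) u v.
        (\<forall>i<n. c \<le> u i \<and> u i \<le> v i \<and> v i \<le> d) \<longrightarrow>
        disjoint_family_on (\<lambda>i. {u i<..<v i}) {..<n} \<longrightarrow>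
        (\<Sum>i<n. v i - u i) < \<delta> \<longrightarrow> (\<Sum>i<n. norm (f (v i) - f (u i))) < e"
    using assms(2,3) \<open>\<delta> > 0\<close> by (intro exI[of _ \<delta>] conjI allI impI \<delta>) (auto intro: order_trans)
qed

lemma absolutely_continuous_fun_imp_continuous_on:
  assumes "absolutely_continuous_fun a b f"
  shows "continuous_on {a..b} f"
  unfolding continuous_on_iff
proof (intro ballI allI impI)
  fix x e :: real assume x: "x \<in> {a..b}" and "e > 0"
  obtain \<delta> where "\<delta> > 0" and \<delta>: "\<And>(n::nat) u v. (\<forall>i<n. a \<le> u i \<and> u i \<le> v i \<and> v i \<le> b) \<Longrightarrow>
        disjoint_family_on (\<lambda>i. {u i<..<v i}) {..<n} \<Longrightarrow> (\<Sum>i<n. v i - u i) < \<delta> \<Longrightarrow>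
        (\<Sum>i<n. norm (f (v i) - f (u i))) < e"
    by (rule absolutely_continuous_funE[OF assms \<open>e > 0\<close>]) (rule that)
  have "dist (f y) (f x) < e" if "y \<in> {a..b}" "dist y x < \<delta>" for y
  proof -
    have "(\<Sum>i<1::nat. norm (f (max x y) - f (min x y))) < e"
      by (rule \<delta>) (use x that in \<open>auto simp: disjoint_family_on_def dist_real_def\<close>)
    then show ?thesis by (auto simp: max_def min_def dist_norm norm_minus_commute split: if_splits)
  qed
  then show "\<exists>d>0. \<forall>y\<in>{a..b}. dist y x < d \<longrightarrow> dist (f y) (f x) < e"
    using \<open>\<delta> > 0\<close> by blast
qed

subsection \<open>Solutions in characteristic coordinates\<close>

text \<open>A differential form of the mild system: each projection is differentiated only along the
  characteristic on which the integral equations use it. Derivatives within the sections of the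
  triangle include its boundary, so integration may start there.\<close>

definition char_solution :: "real \<Rightarrow> (real \<Rightarrow> complex^2^2) \<Rightarrow> (real \<Rightarrow> real \<Rightarrow> complex^2^2) \<Rightarrow> bool" where
  "char_solution b Q W \<longleftrightarrow>
     continuous_on (char_triangle b) (\<lambda>(\<xi>, \<eta>). W (\<xi> + \<eta>) (\<xi> - \<eta>)) \<and>
     (\<forall>(\<xi>, \<eta>) \<in> char_triangle b.
        ((\<lambda>u. Pminus (W (u + \<eta>) (u - \<eta>))) has_vector_derivative
            matB ** Q (\<xi> + \<eta>) ** Pplus (W (\<xi> + \<eta>) (\<xi> - \<eta>))) (at \<xi> within {0..b - \<eta>}) \<and>
        ((\<lambda>v. Pplus (W (\<xi> + v) (\<xi> - v))) has_vector_derivative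
            matB ** Q (\<xi> + \<eta>) ** Pminus (W (\<xi> + \<eta>) (\<xi> - \<eta>))) (at \<eta> within {0..b - \<xi>}))"

section \<open>Stability of the solution class under linear operations\<close>

lemmas linear_Pplus = bounded_linear.linear[OF bounded_linear_Pplus]
lemmas linear_Pminus = bounded_linear.linear[OF bounded_linear_Pminus]

interpretation mat2: bounded_bilinear "(**) :: complex^2^2 \<Rightarrow> complex^2^2 \<Rightarrow> complex^2^2"
  by (rule bounded_bilinear_matrix2_mult)

lemma Pplus_cscale: "Pplus (cscale c A) = cscale c (Pplus A)"
  by (cases A rule: matrix2_cases) (simp add: matrix2_arith field_simps)

lemma Pminus_cscale: "Pminus (cscale c A) = cscale c (Pminus A)"
  by (cases A rule: matrix2_cases) (simp add: matrix2_arith field_simps)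

lemma mult_cscale: "A ** cscale c B = cscale c (A ** B)"
  by (cases A rule: matrix2_cases; cases B rule: matrix2_cases) (simp add: matrix2_arith algebra_simps)

lemma char_solution_0: "char_solution b Q (\<lambda>x t. 0)"
  by (simp add: char_solution_def linear_0[OF linear_Pplus] linear_0[OF linear_Pminus] mat2.zero_right)

lemma char_solution_add:
  assumes "char_solution b Q V" "char_solution b Q W"
  shows "char_solution b Q (\<lambda>x t. V x t + W x t)"
  using assms unfolding char_solution_def
  by (auto simp: linear_add[OF linear_Pplus] linear_add[OF linear_Pminus] mat2.add_right split_def
      intro!: continuous_on_add has_vector_derivative_add)

lemma char_solution_sum:
  assumes "\<And>i. i \<in> I \<Longrightarrow> char_solution b Q (W i)"
  shows "char_solution b Q (\<lambda>x t. \<Sum>i\<in>I. W i x t)"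
  using assms by (induction I rule: infinite_finite_induct) (auto intro: char_solution_0 char_solution_add)

lemma char_solution_cscale:
  assumes "char_solution b Q W"
  shows "char_solution b Q (\<lambda>x t. cscale c (W x t))"
  using assms unfolding char_solution_def
  by (auto simp: Pplus_cscale Pminus_cscale mult_cscale split_def
      intro!: bounded_linear.continuous_on[OF bounded_linear_cscale] bounded_linear.has_vector_derivative[OF bounded_linear_cscale])

text \<open>Right multiplication by \<open>matB\<close> commutes with A -> BAB, hence with both
  projections. It later yields \<open>O2\<close> from \<open>O1\<close> and \<open>O4\<close> from
  \<open>O3\<close>.\<close>

lemma char_solution_mult_matB:
  assumes "char_solution b Q W"
  shows "char_solution b Q (\<lambda>x t. W x t ** matB)"
  using assms unfolding char_solution_def
  by (auto simp: Pplus_mult_matB Pminus_mult_matB matrix_mul_assoc split_def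
      intro!: mat2.continuous_on bounded_linear.has_vector_derivative[OF mat2.bounded_linear_left])

text \<open>The absorption identity
  \<open>(k + 1) * (m choose (k + 1)) = (m - k) * (m choose k)\<close> shifts the index in the t
  derivative of a binomial sum, so that it matches the terms that the x derivative produces. The
  truncated \<open>k - 1\<close> and \<open>m - k - 1\<close> occur only with a factor 0.\<close>

lemma sum_binomial_derivative:
  fixes t :: real and A :: "nat \<Rightarrow> nat \<Rightarrow> 'a :: real_vector"
  shows "(\<Sum>k\<le>m. (real (m choose k) * (real k * t ^ (k - 1))) *\<^sub>R A (m - k) k)
       = (\<Sum>k\<le>m. (real (m choose k) * t ^ k * real (m - k)) *\<^sub>R A (m - k - 1) (Suc k))"
proof (cases m)
  case (Suc n)
  have binom: "real (Suc n choose Suc k) * real (Suc k) = real (Suc n choose k) * real (Suc n - k)" if "k \<le> n" for k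
    using that by (metis (no_types) binomial_absorb_comp mult.commute Suc_times_binomial diff_Suc_1 of_nat_mult)
  have "(\<Sum>k\<le>Suc n. (real (Suc n choose k) * (real k * t ^ (k - 1))) *\<^sub>R A (Suc n - k) k)
      = (\<Sum>k\<le>n. (real (Suc n choose Suc k) * (real (Suc k) * t ^ k)) *\<^sub>R A (n - k) (Suc k))"
    unfolding sum.atMost_Suc_shift by simp
  also have "\<dots> = (\<Sum>k\<le>n. (real (Suc n choose k) * t ^ k * real (Suc n - k)) *\<^sub>R A (Suc n - k - 1) (Suc k))"
  proof (rule sum.cong[OF refl])
    fix k assume "k \<in> {..n}"
    then have "real (Suc n choose Suc k) * (real (Suc k) * t ^ k) = real (Suc n choose k) * t ^ k * real (Suc n - k)"
      "n - k = Suc n - k - 1"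
      using binom[of k] by (simp_all only: mult.assoc[symmetric]) (auto simp: mult.commute mult.left_commute)
    then show "(real (Suc n choose Suc k) * (real (Suc k) * t ^ k)) *\<^sub>R A (n - k) (Suc k)
        = (real (Suc n choose k) * t ^ k * real (Suc n - k)) *\<^sub>R A (Suc n - k - 1) (Suc k)"
      by simp
  qed
  also have "\<dots> = (\<Sum>k\<le>Suc n. (real (Suc n choose k) * t ^ k * real (Suc n - k)) *\<^sub>R A (Suc n - k - 1) (Suc k))"
    by simp
  finally show ?thesis using Suc by simp
qed simp

lemma has_vector_derivative_translate:
  assumes "(f has_vector_derivative f') (at (x + c) within T)" "\<And>u. u \<in> S \<Longrightarrow> u + c \<in> T"
  shows "((\<lambda>u. f (u + c)) has_vector_derivative f') (at x within S)"
proof -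
  have "((\<lambda>u. u + c) has_vector_derivative 1) (at x within S)"
    by (auto intro!: derivative_eq_intros)
  from vector_diff_chain_within[OF this has_vector_derivative_within_subset[OF assms(1)]] assms(2)
  show ?thesis by (auto simp: o_def)
qed

text \<open>The first index of \<open>G\<close> is the order of the power, the second the exponent
  of \<open>t\<close>, whose parity will select a column. The inhomogeneity in the derivative of
  \<open>G\<close> is chosen so that its binomial sum is B W_t B.\<close>

lemma char_solution_binomial_family:
  fixes G :: "nat \<Rightarrow> nat \<Rightarrow> real \<Rightarrow> complex^2^2"
  assumes G: "\<And>n k x. x \<in> {0..b} \<Longrightarrow> (G n k has_vector_derivative
      matB ** potential p q x ** G n k x + real n *\<^sub>R (matB ** G (n - 1) (Suc k) x ** matB)) (at x within {0..b})"
  shows "char_solution b (potential p q) (\<lambda>x t. \<Sum>k\<le>m. (real (m choose k) * t ^ k) *\<^sub>R G (m - k) k x)"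
    (is "char_solution b ?Q ?W")
proof -
  define Wx where "Wx x t = (\<Sum>k\<le>m. (real (m choose k) * t ^ k) *\<^sub>R
      (matB ** ?Q x ** G (m - k) k x + real (m - k) *\<^sub>R (matB ** G (m - k - 1) (Suc k) x ** matB)))" for x t
  define Wt where "Wt x t = (\<Sum>k\<le>m. (real (m choose k) * (real k * t ^ (k - 1))) *\<^sub>R G (m - k) k x)" for x t
  \<comment> \<open>This is B W_x + W_t B = - Q W multiplied from the left by - B.\<close>
  have eq: "Wx x t = matB ** ?Q x ** ?W x t + matB ** Wt x t ** matB" for x t
    unfolding Wx_def Wt_def sum_binomial_derivative[where A = "\<lambda>n k. G n k x"]
    by (simp add: mat2.sum_right mat2.sum_left mat2.scaleR_right mat2.scaleR_left scaleR_add_right sum.distrib)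
  \<comment> \<open>The t derivative drops out: \<open>Pminus\<close> changes sign under A -> BAB
    while \<open>Pplus\<close> is invariant, which fits the sum here and the difference
    below.\<close>
  have Pm: "Pminus (Wx x t + Wt x t) = matB ** ?Q x ** Pplus (?W x t)" for x t
    by (simp add: eq linear_add[OF linear_Pminus] Pminus_potential_mult Pminus_conj)
  have Pp: "Pplus (Wx x t - Wt x t) = matB ** ?Q x ** Pminus (?W x t)" for x t
    by (simp add: eq linear_add[OF linear_Pplus] linear_diff[OF linear_Pplus] Pplus_potential_mult Pplus_conj)
  have cont: "continuous_on {0..b} (G n k)" for n k
    using G has_vector_derivative_continuous continuous_on_eq_continuous_within by blast
  show ?thesis
    unfolding char_solution_def
  proof (intro conjI ballI; clarify?)
    have "continuous_on (char_triangle b) (\<lambda>z. G n k (fst z + snd z))" for n k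
      by (rule continuous_on_compose2[OF cont]) (auto intro!: continuous_intros simp: char_triangle_def)
    then show "continuous_on (char_triangle b) (\<lambda>(\<xi>, \<eta>). ?W (\<xi> + \<eta>) (\<xi> - \<eta>))"
      unfolding split_def by (intro continuous_intros)
  next
    fix \<xi> \<eta> assume "(\<xi>, \<eta>) \<in> char_triangle b"
    then have "0 \<le> \<xi>" "0 \<le> \<eta>" "\<xi> + \<eta> \<le> b" by (auto simp: char_triangle_def)
    show "((\<lambda>u. Pminus (?W (u + \<eta>) (u - \<eta>))) has_vector_derivative
            matB ** ?Q (\<xi> + \<eta>) ** Pplus (?W (\<xi> + \<eta>) (\<xi> - \<eta>))) (at \<xi> within {0..b - \<eta>}) \<and>
        ((\<lambda>v. Pplus (?W (\<xi> + v) (\<xi> - v))) has_vector_derivative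
            matB ** ?Q (\<xi> + \<eta>) ** Pminus (?W (\<xi> + \<eta>) (\<xi> - \<eta>))) (at \<eta> within {0..b - \<xi>})"
    proof
      have dG: "((\<lambda>u. G n k (u + \<eta>)) has_vector_derivative
          matB ** ?Q (\<xi> + \<eta>) ** G n k (\<xi> + \<eta>)
             + real n *\<^sub>R (matB ** G (n - 1) (Suc k) (\<xi> + \<eta>) ** matB)) (at \<xi> within {0..b - \<eta>})" for n k
        by (rule has_vector_derivative_translate[OF G]) (use \<open>0 \<le> \<xi>\<close> \<open>0 \<le> \<eta>\<close> \<open>\<xi> + \<eta> \<le> b\<close> in auto)
      \<comment> \<open>Along the first characteristic x and t grow together, so the chain rule
        gives the sum of the partial derivatives; along the second one t decreases, which gives
        their difference.\<close>
      have "((\<lambda>u. ?W (u + \<eta>) (u - \<eta>)) has_vector_derivative Wx (\<xi> + \<eta>) (\<xi> - \<eta>) + Wt (\<xi> + \<eta>) (\<xi> - \<eta>))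
           (at \<xi> within {0..b - \<eta>})"
        unfolding Wx_def Wt_def sum.distrib[symmetric]
        by (intro has_vector_derivative_sum has_vector_derivative_scaleR dG) (auto intro!: derivative_eq_intros)
      then show "((\<lambda>u. Pminus (?W (u + \<eta>) (u - \<eta>))) has_vector_derivative
            matB ** ?Q (\<xi> + \<eta>) ** Pplus (?W (\<xi> + \<eta>) (\<xi> - \<eta>))) (at \<xi> within {0..b - \<eta>})"
        unfolding Pm[symmetric] by (rule bounded_linear.has_vector_derivative[OF bounded_linear_Pminus])
    next
      have dG: "((\<lambda>v. G n k (\<xi> + v)) has_vector_derivative
          matB ** ?Q (\<xi> + \<eta>) ** G n k (\<xi> + \<eta>)
             + real n *\<^sub>R (matB ** G (n - 1) (Suc k) (\<xi> + \<eta>) ** matB)) (at \<eta> within {0..b - \<xi>})" for n k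
        unfolding add.commute[of \<xi>]
        by (rule has_vector_derivative_translate[OF G]) (use \<open>0 \<le> \<xi>\<close> \<open>0 \<le> \<eta>\<close> \<open>\<xi> + \<eta> \<le> b\<close> in auto)
      have "((\<lambda>v. ?W (\<xi> + v) (\<xi> - v)) has_vector_derivative Wx (\<xi> + \<eta>) (\<xi> - \<eta>) - Wt (\<xi> + \<eta>) (\<xi> - \<eta>))
           (at \<eta> within {0..b - \<xi>})"
        unfolding Wx_def Wt_def sum_subtractf[symmetric] diff_conv_add_uminus[of "_ *\<^sub>R _"] scaleR_minus_left[symmetric]
        by (intro has_vector_derivative_sum has_vector_derivative_scaleR dG) (auto intro!: derivative_eq_intros)
      then show "((\<lambda>v. Pplus (?W (\<xi> + v) (\<xi> - v))) has_vector_derivative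
            matB ** ?Q (\<xi> + \<eta>) ** Pminus (?W (\<xi> + \<eta>) (\<xi> - \<eta>))) (at \<eta> within {0..b - \<xi>})"
        unfolding Pp[symmetric] by (rule bounded_linear.has_vector_derivative[OF bounded_linear_Pplus])
    qed
  qed
qed

subsection \<open>Stability of the Goursat problem\<close>

lemma compact_char_triangle: "compact (char_triangle b)"
proof -
  have "char_triangle b = {z. 0 \<le> fst z} \<inter> {z. 0 \<le> snd z} \<inter> {z. fst z + snd z \<le> b}"
    by (auto simp: char_triangle_def)
  moreover have "closed {z :: real \<times> real. 0 \<le> fst z}" "closed {z :: real \<times> real. 0 \<le> snd z}"
    "closed {z :: real \<times> real. fst z + snd z \<le> b}"
    by (intro closed_Collect_le continuous_intros)+
  ultimately have "closed (char_triangle b)" by auto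
  moreover have "char_triangle b \<subseteq> cbox (0, 0) (b, b)"
    by (auto simp: char_triangle_def cbox_Pair_eq)
  ultimately show ?thesis
    by (meson bounded_cbox bounded_subset compact_eq_bounded_closed)
qed

text \<open>Integrating the exponential weight gains the factor \<open>1 / c\<close>, which the
  contraction argument sets against \<open>L\<close>.\<close>

lemma integral_exp_mult:
  fixes c :: real assumes "c > 0" "0 \<le> y"
  shows "integral {0..y} (\<lambda>v. exp (c * (x + v))) = (exp (c * (x + y)) - exp (c * x)) / c"
proof -
  have "((\<lambda>v. exp (c * (x + v))) has_integral (exp (c * (x + y)) / c - exp (c * (x + 0)) / c)) {0..y}"
  proof (rule fundamental_theorem_of_calculus[OF assms(2)])
    fix v
    show "((\<lambda>v. exp (c * (x + v)) / c) has_vector_derivative exp (c * (x + v))) (at v within {0..y})"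
      unfolding has_real_derivative_iff_has_vector_derivative[symmetric]
      using assms(1) by (auto intro!: derivative_eq_intros)
  qed
  then show ?thesis by (simp add: integral_unique diff_divide_distrib)
qed

text \<open>The weight \<open>exp (- 2 L (\<xi> + \<eta>))\<close> turns the coupled Volterra operator into a contraction with constant \<open>1/2\<close>.\<close>

lemma goursat_gronwall:
  fixes A B :: "real \<Rightarrow> real \<Rightarrow> real"
  assumes "L > 0" "0 \<le> r"
    and A: "continuous_on (char_triangle b) (\<lambda>(\<xi>, \<eta>). A \<xi> \<eta>)"
    and B: "continuous_on (char_triangle b) (\<lambda>(\<xi>, \<eta>). B \<xi> \<eta>)"
    and A_le: "\<And>\<xi> \<eta>. (\<xi>, \<eta>) \<in> char_triangle b \<Longrightarrow> A \<xi> \<eta> \<le> r + L * integral {0..\<eta>} (\<lambda>v. B \<xi> v)"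
    and B_le: "\<And>\<xi> \<eta>. (\<xi>, \<eta>) \<in> char_triangle b \<Longrightarrow> B \<xi> \<eta> \<le> r + L * integral {0..\<xi>} (\<lambda>u. A u \<eta>)"
    and in_triangle: "(\<xi>, \<eta>) \<in> char_triangle b"
  shows "max (A \<xi> \<eta>) (B \<xi> \<eta>) \<le> 2 * r * exp (2 * L * b)"
proof -
  define F where "F z = max (A (fst z) (snd z)) (B (fst z) (snd z)) * exp (- (2 * L * (fst z + snd z)))" for z
  have "continuous_on (char_triangle b) F"
    using A B unfolding F_def split_def by (intro continuous_intros)
  then obtain z0 where z0: "z0 \<in> char_triangle b" "\<And>z. z \<in> char_triangle b \<Longrightarrow> F z \<le> F z0"
    using continuous_attains_sup[OF compact_char_triangle] in_triangle by (metis empty_iff)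
  \<comment> \<open>The cut at 0 makes \<open>S\<close> nonnegative, since the signs of
    \<open>A\<close> and \<open>B\<close> are arbitrary.\<close>
  define S where "S = max 0 (F z0)"
  have S: "0 \<le> S" by (simp add: S_def)
  have bound: "A x y \<le> S * exp (2 * L * (x + y))" "B x y \<le> S * exp (2 * L * (x + y))"
    if "(x, y) \<in> char_triangle b" for x y
  proof -
    have "max (A x y) (B x y) = F (x, y) * exp (2 * L * (x + y))"
      by (simp add: F_def exp_minus)
    also have "\<dots> \<le> S * exp (2 * L * (x + y))"
      using z0(2)[OF that] by (intro mult_right_mono) (auto simp: S_def)
    finally show "A x y \<le> S * exp (2 * L * (x + y))" "B x y \<le> S * exp (2 * L * (x + y))" by auto
  qed
  \<comment> \<open>One pass through the integral inequalities: integrating the weight contributes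
    \<open>1 / (2 * L)\<close>, and the factor \<open>L\<close> in front leaves one half of the
    weighted bound.\<close>
  have half: "max (A x y) (B x y) \<le> r + S * exp (2 * L * (x + y)) / 2" if "(x, y) \<in> char_triangle b" for x y
  proof -
    have xy: "0 \<le> x" "0 \<le> y" "x + y \<le> b" using that by (auto simp: char_triangle_def)
    have "integral {0..y} (\<lambda>v. B x v) \<le> integral {0..y} (\<lambda>v. S * exp (2 * L * (x + v)))"
    proof (rule integral_le)
      show "(\<lambda>v. B x v) integrable_on {0..y}"
        by (intro integrable_continuous_real continuous_on_compose2[OF B[unfolded split_def], of _ "\<lambda>v. (x, v)", simplified])
           (use xy in \<open>auto intro!: continuous_intros simp: char_triangle_def\<close>)
      show "(\<lambda>v. S * exp (2 * L * (x + v))) integrable_on {0..y}"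
        by (intro integrable_continuous_real continuous_intros)
      show "B x v \<le> S * exp (2 * L * (x + v))" if "v \<in> {0..y}" for v
        using xy that by (intro bound) (auto simp: char_triangle_def)
    qed
    also have "\<dots> = S * ((exp (2 * L * (x + y)) - exp (2 * L * x)) / (2 * L))"
      using integral_exp_mult[of "2 * L" y x] \<open>L > 0\<close> xy by simp
    also have "\<dots> \<le> S * (exp (2 * L * (x + y)) / (2 * L))"
      using S \<open>L > 0\<close> by (intro mult_left_mono divide_right_mono) auto
    finally have "L * integral {0..y} (\<lambda>v. B x v) \<le> L * (S * (exp (2 * L * (x + y)) / (2 * L)))"
      using \<open>L > 0\<close> by (intro mult_left_mono) auto
    then have 1: "L * integral {0..y} (\<lambda>v. B x v) \<le> S * exp (2 * L * (x + y)) / 2"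
      using \<open>L > 0\<close> by simp
    have "integral {0..x} (\<lambda>u. A u y) \<le> integral {0..x} (\<lambda>u. S * exp (2 * L * (y + u)))"
    proof (rule integral_le)
      show "(\<lambda>u. A u y) integrable_on {0..x}"
        by (intro integrable_continuous_real continuous_on_compose2[OF A[unfolded split_def], of _ "\<lambda>u. (u, y)", simplified])
           (use xy in \<open>auto intro!: continuous_intros simp: char_triangle_def\<close>)
      show "(\<lambda>u. S * exp (2 * L * (y + u))) integrable_on {0..x}"
        by (intro integrable_continuous_real continuous_intros)
      show "A u y \<le> S * exp (2 * L * (y + u))" if "u \<in> {0..x}" for u
        using xy that bound(1)[of u y] by (auto simp: char_triangle_def add.commute)
    qed
    also have "\<dots> = S * ((exp (2 * L * (y + x)) - exp (2 * L * y)) / (2 * L))"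
      using integral_exp_mult[of "2 * L" x y] \<open>L > 0\<close> xy by simp
    also have "\<dots> \<le> S * (exp (2 * L * (y + x)) / (2 * L))"
      using S \<open>L > 0\<close> by (intro mult_left_mono divide_right_mono) auto
    finally have "L * integral {0..x} (\<lambda>u. A u y) \<le> L * (S * (exp (2 * L * (y + x)) / (2 * L)))"
      using \<open>L > 0\<close> by (intro mult_left_mono) auto
    then have 2: "L * integral {0..x} (\<lambda>u. A u y) \<le> S * exp (2 * L * (x + y)) / 2"
      using \<open>L > 0\<close> by (simp add: add.commute)
    show ?thesis using A_le[OF that] B_le[OF that] 1 2 by linarith
  qed
  have "F z0 \<le> r + S / 2"
  proof -
    obtain x y where z: "z0 = (x, y)" by fastforce
    then have xy: "0 \<le> x + y" using z0(1) by (auto simp: char_triangle_def)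
    have "F z0 \<le> (r + S * exp (2 * L * (x + y)) / 2) * exp (- (2 * L * (x + y)))"
      using half[of x y] z0(1) unfolding F_def z by (simp add: mult_right_mono)
    also have "\<dots> = r * exp (- (2 * L * (x + y))) + S / 2"
    proof -
      have "exp (2 * L * (x + y)) * exp (- (2 * L * (x + y))) = 1"
        by (simp add: exp_minus)
      then show ?thesis by (simp add: distrib_right mult.assoc del: exp_minus_inverse)
    qed
    also have "\<dots> \<le> r + S / 2"
      using \<open>0 \<le> r\<close> xy \<open>L > 0\<close> by (simp add: mult_left_le)
    finally show ?thesis .
  qed
  \<comment> \<open>At the maximum point the estimate reads \<open>S \<le> r + S / 2\<close>, so
    \<open>S\<close> is absorbed into the left side.\<close>
  then have "S \<le> 2 * r" using \<open>0 \<le> r\<close> S by (auto simp: S_def max_def split: if_splits)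
  moreover have "exp (2 * L * (\<xi> + \<eta>)) \<le> exp (2 * L * b)"
    using in_triangle \<open>L > 0\<close> by (auto simp: char_triangle_def)
  ultimately have "S * exp (2 * L * (\<xi> + \<eta>)) \<le> 2 * r * exp (2 * L * b)"
    using S by (intro mult_mono) auto
  then show ?thesis using bound[OF in_triangle] by simp
qed

text \<open>Each equation is integrated along its characteristic from the edge of the triangle:
  \<open>Pminus\<close> starts at \<open>\<xi> = 0\<close>, which is t = -x, and
  \<open>Pplus\<close> starts at \<open>\<eta> = 0\<close>, which is t = x.\<close>

lemma char_solution_integral:
  assumes Q: "continuous_on {0..b} Q" and W: "char_solution b Q W" and t: "(\<xi>, \<eta>) \<in> char_triangle b"
  shows "Pminus (W (\<xi> + \<eta>) (\<xi> - \<eta>)) = Pminus (W \<eta> (- \<eta>))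
      + integral {0..\<xi>} (\<lambda>u. matB ** Q (u + \<eta>) ** Pplus (W (u + \<eta>) (u - \<eta>)))"
    and "Pplus (W (\<xi> + \<eta>) (\<xi> - \<eta>)) = Pplus (W \<xi> \<xi>)
      + integral {0..\<eta>} (\<lambda>v. matB ** Q (\<xi> + v) ** Pminus (W (\<xi> + v) (\<xi> - v)))"
proof -
  have xy: "0 \<le> \<xi>" "0 \<le> \<eta>" "\<xi> + \<eta> \<le> b" using t by (auto simp: char_triangle_def)
  have "((\<lambda>u. matB ** Q (u + \<eta>) ** Pplus (W (u + \<eta>) (u - \<eta>))) has_integral
     Pminus (W (\<xi> + \<eta>) (\<xi> - \<eta>)) - Pminus (W (0 + \<eta>) (0 - \<eta>))) {0..\<xi>}"
  proof (rule fundamental_theorem_of_calculus[OF xy(1)])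
    fix u assume "u \<in> {0..\<xi>}"
    then have u: "(u, \<eta>) \<in> char_triangle b" "{0..\<xi>} \<subseteq> {0..b - \<eta>}" using xy by (auto simp: char_triangle_def)
    show "((\<lambda>u. Pminus (W (u + \<eta>) (u - \<eta>))) has_vector_derivative
        matB ** Q (u + \<eta>) ** Pplus (W (u + \<eta>) (u - \<eta>))) (at u within {0..\<xi>})"
      by (rule has_vector_derivative_within_subset[OF _ u(2)])
         (use W u(1) in \<open>fastforce simp: char_solution_def\<close>)
  qed
  then show "Pminus (W (\<xi> + \<eta>) (\<xi> - \<eta>)) = Pminus (W \<eta> (- \<eta>))
      + integral {0..\<xi>} (\<lambda>u. matB ** Q (u + \<eta>) ** Pplus (W (u + \<eta>) (u - \<eta>)))"
    by (simp add: integral_unique)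
  have "((\<lambda>v. matB ** Q (\<xi> + v) ** Pminus (W (\<xi> + v) (\<xi> - v))) has_integral
     Pplus (W (\<xi> + \<eta>) (\<xi> - \<eta>)) - Pplus (W (\<xi> + 0) (\<xi> - 0))) {0..\<eta>}"
  proof (rule fundamental_theorem_of_calculus[OF xy(2)])
    fix v assume "v \<in> {0..\<eta>}"
    then have v: "(\<xi>, v) \<in> char_triangle b" "{0..\<eta>} \<subseteq> {0..b - \<xi>}" using xy by (auto simp: char_triangle_def)
    show "((\<lambda>v. Pplus (W (\<xi> + v) (\<xi> - v))) has_vector_derivative
        matB ** Q (\<xi> + v) ** Pminus (W (\<xi> + v) (\<xi> - v))) (at v within {0..\<eta>})"
      by (rule has_vector_derivative_within_subset[OF _ v(2)])
         (use W v(1) in \<open>fastforce simp: char_solution_def\<close>)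
  qed
  then show "Pplus (W (\<xi> + \<eta>) (\<xi> - \<eta>)) = Pplus (W \<xi> \<xi>)
      + integral {0..\<eta>} (\<lambda>v. matB ** Q (\<xi> + v) ** Pminus (W (\<xi> + v) (\<xi> - v)))"
    by (simp add: integral_unique)
qed

lemma integrable_along_char:
  assumes Q: "continuous_on {0..b} Q"
    and H: "continuous_on (char_triangle b) (\<lambda>(\<xi>, \<eta>). H \<xi> \<eta> :: complex^2^2)"
    and t: "(\<xi>, \<eta>) \<in> char_triangle b" and "bounded_linear (P :: complex^2^2 \<Rightarrow> complex^2^2)"
  shows "(\<lambda>u. matB ** Q (u + \<eta>) ** P (H u \<eta>)) integrable_on {0..\<xi>}"
    and "(\<lambda>v. matB ** Q (\<xi> + v) ** P (H \<xi> v)) integrable_on {0..\<eta>}"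
proof -
  have xy: "0 \<le> \<xi>" "0 \<le> \<eta>" "\<xi> + \<eta> \<le> b" using t by (auto simp: char_triangle_def)
  have "continuous_on {0..\<xi>} (\<lambda>u. P (H u \<eta>))"
    by (intro bounded_linear.continuous_on[OF \<open>bounded_linear P\<close>] continuous_on_compose2[OF H[unfolded split_def], of _ "\<lambda>u. (u, \<eta>)", simplified])
       (use xy in \<open>auto intro!: continuous_intros simp: char_triangle_def\<close>)
  moreover have "continuous_on {0..\<xi>} (\<lambda>u. Q (u + \<eta>))"
    by (rule continuous_on_compose2[OF Q]) (use xy in \<open>auto intro!: continuous_intros\<close>)
  ultimately show "(\<lambda>u. matB ** Q (u + \<eta>) ** P (H u \<eta>)) integrable_on {0..\<xi>}"
    by (intro integrable_continuous_real mat2.continuous_on continuous_on_const)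
  have "continuous_on {0..\<eta>} (\<lambda>v. P (H \<xi> v))"
    by (intro bounded_linear.continuous_on[OF \<open>bounded_linear P\<close>] continuous_on_compose2[OF H[unfolded split_def], of _ "\<lambda>v. (\<xi>, v)", simplified])
       (use xy in \<open>auto intro!: continuous_intros simp: char_triangle_def\<close>)
  moreover have "continuous_on {0..\<eta>} (\<lambda>v. Q (\<xi> + v))"
    by (rule continuous_on_compose2[OF Q]) (use xy in \<open>auto intro!: continuous_intros\<close>)
  ultimately show "(\<lambda>v. matB ** Q (\<xi> + v) ** P (H \<xi> v)) integrable_on {0..\<eta>}"
    by (intro integrable_continuous_real mat2.continuous_on continuous_on_const)
qed

text \<open>The term BQ/2 lies in the range of \<open>Pplus\<close>. Since multiplication by BQ
  exchanges the ranges, the integral over \<open>u\<close> lies in that of \<open>Pminus\<close> and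
  the integral over \<open>v\<close> in that of \<open>Pplus\<close>. Hence the mild equation splits
  into the integral equations of \<open>char_solution_integral\<close>, with boundary data BQ/2 on t
  = x and 0 on t = -x.\<close>

lemma integral_kernel_components:
  assumes Q: "continuous_on {0..b} (potential p q)"
    and K: "integral_kernel b (potential p q) K" and t: "(\<xi>, \<eta>) \<in> char_triangle b"
  shows "Pminus (K (\<xi> + \<eta>) (\<xi> - \<eta>)) =
      integral {0..\<xi>} (\<lambda>u. matB ** potential p q (u + \<eta>) ** Pplus (K (u + \<eta>) (u - \<eta>)))"
    and "Pplus (K (\<xi> + \<eta>) (\<xi> - \<eta>)) = (1 / 2) *\<^sub>R (matB ** potential p q \<xi>)
      + integral {0..\<eta>} (\<lambda>v. matB ** potential p q (\<xi> + v) ** Pminus (K (\<xi> + v) (\<xi> - v)))"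
proof -
  have H: "continuous_on (char_triangle b) (\<lambda>(\<xi>, \<eta>). K (\<xi> + \<eta>) (\<xi> - \<eta>))"
    and eq: "K (\<xi> + \<eta>) (\<xi> - \<eta>) = (1 / 2) *\<^sub>R (matB ** potential p q \<xi>)
            + integral {0..\<xi>} (\<lambda>u. matB ** potential p q (u + \<eta>) ** Pplus (K (u + \<eta>) (u - \<eta>)))
            + integral {0..\<eta>} (\<lambda>v. matB ** potential p q (\<xi> + v) ** Pminus (K (\<xi> + v) (\<xi> - v)))"
    using K t unfolding integral_kernel_def Let_def by auto
  note int = integrable_along_char(1)[OF Q H t bounded_linear_Pplus]
    integrable_along_char(2)[OF Q H t bounded_linear_Pminus]
  show "Pminus (K (\<xi> + \<eta>) (\<xi> - \<eta>)) =
      integral {0..\<xi>} (\<lambda>u. matB ** potential p q (u + \<eta>) ** Pplus (K (u + \<eta>) (u - \<eta>)))"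
    unfolding eq linear_add[OF linear_Pminus] linear_scale[OF linear_Pminus]
      integral_linear[OF int(1) bounded_linear_Pminus, symmetric]
      integral_linear[OF int(2) bounded_linear_Pminus, symmetric] o_def
    by (simp add: Pminus_matB_potential Pminus_potential_mult Pplus_Pplus Pplus_Pminus mat2.zero_right)
  show "Pplus (K (\<xi> + \<eta>) (\<xi> - \<eta>)) = (1 / 2) *\<^sub>R (matB ** potential p q \<xi>)
      + integral {0..\<eta>} (\<lambda>v. matB ** potential p q (\<xi> + v) ** Pminus (K (\<xi> + v) (\<xi> - v)))"
    unfolding eq linear_add[OF linear_Pplus] linear_scale[OF linear_Pplus]
      integral_linear[OF int(1) bounded_linear_Pplus, symmetric]
      integral_linear[OF int(2) bounded_linear_Pplus, symmetric] o_def
    by (simp add: Pplus_matB_potential Pplus_potential_mult Pminus_Pminus Pminus_Pplus mat2.zero_right)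
qed

text \<open>By linearity the projections of \<open>K - W\<close> satisfy the coupled Volterra
  equations with only the boundary errors as data, so \<open>goursat_gronwall\<close> applies.
  \<open>C\<close> is fixed before \<open>K\<close> and \<open>W\<close>, so it depends only on
  \<open>b\<close> and the potential.\<close>

lemma kernel_stability:
  assumes Q: "continuous_on {0..b} (potential p q)"
  obtains C where "\<And>K W r x t. integral_kernel b (potential p q) K \<Longrightarrow> char_solution b (potential p q) W \<Longrightarrow> 0 \<le> r \<Longrightarrow>
    (\<And>x. x \<in> {0..b} \<Longrightarrow> norm ((1 / 2) *\<^sub>R (matB ** potential p q x) - Pplus (W x x)) \<le> r) \<Longrightarrow>
    (\<And>x. x \<in> {0..b} \<Longrightarrow> norm (Pminus (W x (- x))) \<le> r) \<Longrightarrow>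
    (x, t) \<in> Omega b \<Longrightarrow> norm (K x t - W x t) \<le> C * r"
proof -
  have "bounded ((\<lambda>x. matB ** potential p q x) ` {0..b})"
    by (intro compact_imp_bounded compact_continuous_image mat2.continuous_on Q continuous_on_const compact_Icc)
  then obtain q0 where q0: "q0 > 0" "\<And>x. x \<in> {0..b} \<Longrightarrow> norm (matB ** potential p q x) \<le> q0"
    by (auto simp: bounded_pos)
  from mat2.pos_bounded obtain k where k: "k > 0" "\<forall>(A :: complex^2^2) (B :: complex^2^2). norm (A ** B) \<le> norm A * norm B * k"
    by auto
  \<comment> \<open>\<open>L\<close> bounds multiplication by BQ on the interval: \<open>q0\<close>
    bounds BQ, and \<open>k\<close> is the constant of the bounded bilinear matrix product.\<close>
  define L where "L = q0 * k"
  have "L > 0" using q0 k(1) by (simp add: L_def)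
  have BQ: "norm (matB ** potential p q x ** A) \<le> L * norm A" if "x \<in> {0..b}" for x and A :: "complex^2^2"
  proof -
    have "norm (matB ** potential p q x ** A) \<le> norm (matB ** potential p q x) * norm A * k" by (rule k(2)[rule_format])
    also have "\<dots> \<le> q0 * norm A * k" using q0(2)[OF that] k(1) by (intro mult_right_mono) auto
    finally show ?thesis by (simp add: L_def mult_ac)
  qed
  show ?thesis
  \<comment> \<open>The factor 4 arises because \<open>K - W\<close> is the sum of its two
    projections, each bounded by \<open>2 * r * exp (2 * L * b)\<close>.\<close>
  proof (rule that[of "4 * exp (2 * L * b)"])
    fix K W r x t
    assume K: "integral_kernel b (potential p q) K" and W: "char_solution b (potential p q) W" and r: "0 \<le> r"
      and Wplus: "\<And>x. x \<in> {0..b} \<Longrightarrow> norm ((1 / 2) *\<^sub>R (matB ** potential p q x) - Pplus (W x x)) \<le> r"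
      and Wminus: "\<And>x. x \<in> {0..b} \<Longrightarrow> norm (Pminus (W x (- x))) \<le> r"
      and xt: "(x, t) \<in> Omega b"
    define D where "D \<xi> \<eta> = K (\<xi> + \<eta>) (\<xi> - \<eta>) - W (\<xi> + \<eta>) (\<xi> - \<eta>)" for \<xi> \<eta>
    have Kc: "continuous_on (char_triangle b) (\<lambda>(\<xi>, \<eta>). K (\<xi> + \<eta>) (\<xi> - \<eta>))"
      using K by (auto simp: integral_kernel_def Let_def)
    have Wc: "continuous_on (char_triangle b) (\<lambda>(\<xi>, \<eta>). W (\<xi> + \<eta>) (\<xi> - \<eta>))"
      using W by (auto simp: char_solution_def)
    have Dc: "continuous_on (char_triangle b) (\<lambda>(\<xi>, \<eta>). D \<xi> \<eta>)"
      using Kc Wc unfolding D_def split_def by (intro continuous_intros)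
    have Pc: "continuous_on (char_triangle b) (\<lambda>(\<xi>, \<eta>). norm (Pplus (D \<xi> \<eta>)))"
      "continuous_on (char_triangle b) (\<lambda>(\<xi>, \<eta>). norm (Pminus (D \<xi> \<eta>)))"
      using Dc unfolding split_def
      by (auto intro!: continuous_on_norm bounded_linear.continuous_on[OF bounded_linear_Pplus]
        bounded_linear.continuous_on[OF bounded_linear_Pminus])
    have "max (norm (Pplus (D \<xi> \<eta>))) (norm (Pminus (D \<xi> \<eta>))) \<le> 2 * r * exp (2 * L * b)"
      if "(\<xi>, \<eta>) \<in> char_triangle b" for \<xi> \<eta>
    proof (rule goursat_gronwall[OF \<open>L > 0\<close> r Pc _ _ that])
      fix \<xi> \<eta> assume t: "(\<xi>, \<eta>) \<in> char_triangle b"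
      then have xy: "0 \<le> \<xi>" "0 \<le> \<eta>" "\<xi> + \<eta> \<le> b" by (auto simp: char_triangle_def)
      note Pplus_int = integrable_along_char(1)[OF Q _ t bounded_linear_Pplus]
      note Pminus_int = integrable_along_char(2)[OF Q _ t bounded_linear_Pminus]
      have "Pminus (D \<xi> \<eta>) = integral {0..\<xi>} (\<lambda>u. matB ** potential p q (u + \<eta>) ** Pplus (K (u + \<eta>) (u - \<eta>)))
         - integral {0..\<xi>} (\<lambda>u. matB ** potential p q (u + \<eta>) ** Pplus (W (u + \<eta>) (u - \<eta>))) - Pminus (W \<eta> (- \<eta>))"
        unfolding D_def linear_diff[OF linear_Pminus] integral_kernel_components(1)[OF Q K t]
          char_solution_integral(1)[OF Q W t] by simp
      also have "integral {0..\<xi>} (\<lambda>u. matB ** potential p q (u + \<eta>) ** Pplus (K (u + \<eta>) (u - \<eta>)))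
         - integral {0..\<xi>} (\<lambda>u. matB ** potential p q (u + \<eta>) ** Pplus (W (u + \<eta>) (u - \<eta>)))
         = integral {0..\<xi>} (\<lambda>u. matB ** potential p q (u + \<eta>) ** Pplus (D u \<eta>))"
        unfolding D_def linear_diff[OF linear_Pplus] mat2.diff_right
        by (rule integral_diff[symmetric]) (use Pplus_int[OF Kc] Pplus_int[OF Wc] in auto)
      also have "norm (\<dots> - Pminus (W \<eta> (- \<eta>)))
          \<le> norm (integral {0..\<xi>} (\<lambda>u. matB ** potential p q (u + \<eta>) ** Pplus (D u \<eta>))) + norm (Pminus (W \<eta> (- \<eta>)))"
        by (rule norm_triangle_ineq4)
      also have "norm (integral {0..\<xi>} (\<lambda>u. matB ** potential p q (u + \<eta>) ** Pplus (D u \<eta>)))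
          \<le> integral {0..\<xi>} (\<lambda>u. L * norm (Pplus (D u \<eta>)))"
      proof (rule integral_norm_bound_integral)
        show "(\<lambda>u. L * norm (Pplus (D u \<eta>))) integrable_on {0..\<xi>}"
          by (intro integrable_continuous_real continuous_on_mult continuous_on_const
              continuous_on_compose2[OF Pc(1)[unfolded split_def], of _ "\<lambda>u. (u, \<eta>)", simplified])
             (use xy in \<open>auto intro!: continuous_intros simp: char_triangle_def\<close>)
        show "norm (matB ** potential p q (u + \<eta>) ** Pplus (D u \<eta>)) \<le> L * norm (Pplus (D u \<eta>))" if "u \<in> {0..\<xi>}" for u
          by (rule BQ) (use xy that in auto)
      qed (rule Pplus_int[OF Dc])
      finally show "norm (Pminus (D \<xi> \<eta>)) \<le> r + L * integral {0..\<xi>} (\<lambda>u. norm (Pplus (D u \<eta>)))"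
        using Wminus[of \<eta>] xy by simp
      have "Pplus (D \<xi> \<eta>) = integral {0..\<eta>} (\<lambda>v. matB ** potential p q (\<xi> + v) ** Pminus (K (\<xi> + v) (\<xi> - v)))
         - integral {0..\<eta>} (\<lambda>v. matB ** potential p q (\<xi> + v) ** Pminus (W (\<xi> + v) (\<xi> - v)))
         + ((1 / 2) *\<^sub>R (matB ** potential p q \<xi>) - Pplus (W \<xi> \<xi>))"
        unfolding D_def linear_diff[OF linear_Pplus] integral_kernel_components(2)[OF Q K t]
          char_solution_integral(2)[OF Q W t] by simp
      also have "integral {0..\<eta>} (\<lambda>v. matB ** potential p q (\<xi> + v) ** Pminus (K (\<xi> + v) (\<xi> - v)))
         - integral {0..\<eta>} (\<lambda>v. matB ** potential p q (\<xi> + v) ** Pminus (W (\<xi> + v) (\<xi> - v)))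
         = integral {0..\<eta>} (\<lambda>v. matB ** potential p q (\<xi> + v) ** Pminus (D \<xi> v))"
        unfolding D_def linear_diff[OF linear_Pminus] mat2.diff_right
        by (rule integral_diff[symmetric]) (use Pminus_int[OF Kc] Pminus_int[OF Wc] in auto)
      also have "norm (\<dots> + ((1 / 2) *\<^sub>R (matB ** potential p q \<xi>) - Pplus (W \<xi> \<xi>)))
          \<le> norm (integral {0..\<eta>} (\<lambda>v. matB ** potential p q (\<xi> + v) ** Pminus (D \<xi> v)))
            + norm ((1 / 2) *\<^sub>R (matB ** potential p q \<xi>) - Pplus (W \<xi> \<xi>))"
        by (rule norm_triangle_ineq)
      also have "norm (integral {0..\<eta>} (\<lambda>v. matB ** potential p q (\<xi> + v) ** Pminus (D \<xi> v)))
          \<le> integral {0..\<eta>} (\<lambda>v. L * norm (Pminus (D \<xi> v)))"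
      proof (rule integral_norm_bound_integral)
        show "(\<lambda>v. L * norm (Pminus (D \<xi> v))) integrable_on {0..\<eta>}"
          by (intro integrable_continuous_real continuous_on_mult continuous_on_const
              continuous_on_compose2[OF Pc(2)[unfolded split_def], of _ "\<lambda>v. (\<xi>, v)", simplified])
             (use xy in \<open>auto intro!: continuous_intros simp: char_triangle_def\<close>)
        show "norm (matB ** potential p q (\<xi> + v) ** Pminus (D \<xi> v)) \<le> L * norm (Pminus (D \<xi> v))" if "v \<in> {0..\<eta>}" for v
          by (rule BQ) (use xy that in auto)
      qed (rule Pminus_int[OF Dc])
      finally show "norm (Pplus (D \<xi> \<eta>)) \<le> r + L * integral {0..\<eta>} (\<lambda>v. norm (Pminus (D \<xi> v)))"
        using Wplus[of \<xi>] xy by simp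
    qed
    moreover have "((x + t) / 2, (x - t) / 2) \<in> char_triangle b"
      using xt by (auto simp: Omega_def char_triangle_def field_simps)
    moreover have "D ((x + t) / 2) ((x - t) / 2) = K x t - W x t"
      by (simp add: D_def field_simps)
    ultimately have "norm (Pplus (K x t - W x t)) \<le> 2 * r * exp (2 * L * b)"
      "norm (Pminus (K x t - W x t)) \<le> 2 * r * exp (2 * L * b)"
      by (metis max.bounded_iff)+
    then show "norm (K x t - W x t) \<le> 4 * exp (2 * L * b) * r"
      using norm_triangle_ineq[of "Pplus (K x t - W x t)" "Pminus (K x t - W x t)"]
      unfolding Pplus_add_Pminus by (simp add: mult.commute mult.left_commute)
  qed
qed

subsection \<open>Formal powers\<close>

lemma matrix2_vec_nth: "matrix2 a b c d $ 1 $ 1 = a" "matrix2 a b c d $ 1 $ 2 = b"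
  "matrix2 a b c d $ 2 $ 1 = c" "matrix2 a b c d $ 2 $ 2 = d"
  by (simp_all add: matrix2_def)

lemma cols2_eq_matrix2: "cols2 u v = matrix2 (u $ 1) (v $ 1) (u $ 2) (v $ 2)"
  by (simp add: matrix2_simps)

section \<open>Regularity of the particular solution\<close>

lemma continuous_on_potentialD:
  assumes "continuous_on S (potential p q)"
  shows "continuous_on S p" "continuous_on S q"
proof -
  have "continuous_on S (\<lambda>x. potential p q x $ 1 $ 1)" "continuous_on S (\<lambda>x. potential p q x $ 1 $ 2)"
    by (intro continuous_on_component assms)+
  then show "continuous_on S p" "continuous_on S q"
    by (simp_all add: potential_def matrix2_vec_nth)
qed

text \<open>An absolutely continuous \<open>f\<close> is recovered by integrating its almost
  everywhere derivative \<phi>. An integral of a continuous function is differentiable at every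
  point, endpoints included.\<close>

lemma absolutely_continuous_derivative_everywhere:
  fixes f :: "real \<Rightarrow> complex"
  assumes "0 \<le> b" and ac: "absolutely_continuous_fun 0 b f"
    and AE: "AE x in lebesgue. x \<in> {0..b} \<longrightarrow> (f has_vector_derivative \<phi> x) (at x within {0..b})"
    and \<phi>: "continuous_on {0..b} \<phi>" and x: "x \<in> {0..b}"
  shows "(f has_vector_derivative \<phi> x) (at x within {0..b})"
proof -
  obtain N where N: "N \<in> null_sets lebesgue"
    "{x. \<not> (x \<in> {0..b} \<longrightarrow> (f has_vector_derivative \<phi> x) (at x within {0..b}))} \<subseteq> N"
    using AE by (auto simp: eventually_ae_filter)
  have eq: "f y = f 0 + integral {0..y} \<phi>" if "y \<in> {0..b}" for y
  proof -
    have "(\<phi> has_integral f y - f 0) {0..y}"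
    proof (rule fundamental_theorem_of_calculus_absolutely_continuous[where S = N])
      show "absolutely_continuous_fun 0 y f"
        using absolutely_continuous_fun_subinterval[OF ac, of 0 y] that by auto
      show "negligible N" using N(1) by (simp add: negligible_iff_null_sets)
      fix z assume z: "z \<in> {0..y} - N"
      then have "(f has_vector_derivative \<phi> z) (at z within {0..b})" using N(2) that by auto
      then show "(f has_vector_derivative \<phi> z) (at z within {0..y})"
        by (rule has_vector_derivative_within_subset) (use that in auto)
    qed (use that in auto)
    then show ?thesis by (simp add: integral_unique)
  qed
  have "((\<lambda>y. f 0 + integral {0..y} \<phi>) has_vector_derivative 0 + \<phi> x) (at x within {0..b})"
    by (intro has_vector_derivative_add has_vector_derivative_const integral_has_vector_derivative \<phi> x)
  then show ?thesis
    by (intro has_vector_derivative_transform[OF x eq]) auto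
qed

text \<open>Solved for the derivatives, the equations have continuous right sides, so they pass from
  almost every point to every point.\<close>

lemma admissible_solution_derivative:
  assumes "b > 0" and Q: "continuous_on {0..b} (potential p q)" and "admissible_solution b p q f g" "x \<in> {0..b}"
  shows "(f has_vector_derivative q x * f x - p x * g x) (at x within {0..b})"
    and "(g has_vector_derivative - p x * f x - q x * g x) (at x within {0..b})"
proof -
  have ac: "absolutely_continuous_fun 0 b f" "absolutely_continuous_fun 0 b g"
    and AE: "AE x in lebesgue. x \<in> {0..b} \<longrightarrow>
        (\<exists>f' g'. (f has_vector_derivative f') (at x within {0..b}) \<and>
                 (g has_vector_derivative g') (at x within {0..b}) \<and>
                 g' + p x * f x + q x * g x = 0 \<and>
                 - f' + q x * f x - p x * g x = 0)"
    using assms(3) by (auto simp: admissible_solution_def)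
  note cont = ac[THEN absolutely_continuous_fun_imp_continuous_on] continuous_on_potentialD[OF Q]
  show "(f has_vector_derivative q x * f x - p x * g x) (at x within {0..b})"
  proof (rule absolutely_continuous_derivative_everywhere[OF _ ac(1)])
    show "AE x in lebesgue. x \<in> {0..b} \<longrightarrow> (f has_vector_derivative q x * f x - p x * g x) (at x within {0..b})"
      using AE
    proof (rule AE_mp, intro AE_I2 impI)
      fix x assume "x \<in> {0..b} \<longrightarrow>
        (\<exists>f' g'. (f has_vector_derivative f') (at x within {0..b}) \<and>
                 (g has_vector_derivative g') (at x within {0..b}) \<and>
                 g' + p x * f x + q x * g x = 0 \<and>
                 - f' + q x * f x - p x * g x = 0)" "x \<in> {0..b}"
      then obtain f' where f': "(f has_vector_derivative f') (at x within {0..b})" "- f' + q x * f x - p x * g x = 0"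
        by auto
      from f'(2) have "f' = q x * f x - p x * g x" by (simp add: algebra_simps)
      with f'(1) show "(f has_vector_derivative q x * f x - p x * g x) (at x within {0..b})" by simp
    qed
  qed (use assms cont in \<open>auto intro!: continuous_intros\<close>)
  show "(g has_vector_derivative - p x * f x - q x * g x) (at x within {0..b})"
  proof (rule absolutely_continuous_derivative_everywhere[OF _ ac(2)])
    show "AE x in lebesgue. x \<in> {0..b} \<longrightarrow> (g has_vector_derivative - p x * f x - q x * g x) (at x within {0..b})"
      using AE
    proof (rule AE_mp, intro AE_I2 impI)
      fix x assume "x \<in> {0..b} \<longrightarrow>
        (\<exists>f' g'. (f has_vector_derivative f') (at x within {0..b}) \<and>
                 (g has_vector_derivative g') (at x within {0..b}) \<and>
                 g' + p x * f x + q x * g x = 0 \<and>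
                 - f' + q x * f x - p x * g x = 0)" "x \<in> {0..b}"
      then obtain g' where g': "(g has_vector_derivative g') (at x within {0..b})" "g' + p x * f x + q x * g x = 0"
        by auto
      from g'(2) have "g' = - p x * f x - q x * g x" by (simp add: algebra_simps eq_neg_iff_add_eq_0)
      with g'(1) show "(g has_vector_derivative - p x * f x - q x * g x) (at x within {0..b})" by simp
    qed
  qed (use assms cont in \<open>auto intro!: continuous_intros\<close>)
qed

section \<open>Differential equations of the formal powers\<close>

locale dirac_solution =
  fixes b :: real and p q f g :: "real \<Rightarrow> complex"
  assumes b: "0 \<le> b"
    and p: "continuous_on {0..b} p"
    and f: "\<And>x. x \<in> {0..b} \<Longrightarrow> (f has_vector_derivative q x * f x - p x * g x) (at x within {0..b})"
    and g: "\<And>x. x \<in> {0..b} \<Longrightarrow> (g has_vector_derivative - p x * f x - q x * g x) (at x within {0..b})"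
    and nz: "\<And>x. x \<in> {0..b} \<Longrightarrow> f x \<noteq> 0" "\<And>x. x \<in> {0..b} \<Longrightarrow> g x \<noteq> 0"
    and init: "f 0 * g 0 = 1"
begin

lemma continuous_fg: "continuous_on {0..b} f" "continuous_on {0..b} g"
  by (rule continuous_on_vector_derivative[OF f] continuous_on_vector_derivative[OF g], assumption)+

text \<open>In the derivative of f g the terms with \<open>q\<close> cancel and - p (f^2 + g^2)
  remains. Thus 1/(f g) is an antiderivative of p/f^2 + p/g^2, on which the closed forms of X - Y
  below rest.\<close>

lemma has_vector_derivative_inverse_fg:
  assumes "x \<in> {0..b}"
  shows "((\<lambda>x. inverse (f x * g x)) has_vector_derivative p x * ((f x)\<^sup>2 + (g x)\<^sup>2) / (f x * g x)\<^sup>2)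
    (at x within {0..b})"
proof -
  have "((\<lambda>x. f x * g x) has_vector_derivative f x * (- p x * f x - q x * g x) + (q x * f x - p x * g x) * g x)
     (at x within {0..b})"
    by (rule has_vector_derivative_mult[OF f g]) fact+
  moreover have "f x * g x \<noteq> 0" using nz[OF assms] by simp
  then have "(inverse has_field_derivative - inverse ((f x * g x)\<^sup>2))
      (at (f x * g x) within (\<lambda>x. f x * g x) ` {0..b})"
    using DERIV_inverse[of "f x * g x" "(\<lambda>x. f x * g x) ` {0..b}"] by (simp add: numeral_2_eq_2)
  ultimately have "((inverse \<circ> (\<lambda>x. f x * g x)) has_vector_derivative
      (f x * (- p x * f x - q x * g x) + (q x * f x - p x * g x) * g x) * - inverse ((f x * g x)\<^sup>2)) (at x within {0..b})"
    by (rule field_vector_diff_chain_within)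
  moreover have "(f x * (- p x * f x - q x * g x) + (q x * f x - p x * g x) * g x) * - inverse ((f x * g x)\<^sup>2)
      = p x * ((f x)\<^sup>2 + (g x)\<^sup>2) / (f x * g x)\<^sup>2"
    by (simp add: divide_inverse power2_eq_square algebra_simps)
  ultimately show ?thesis by (simp add: o_def)
qed

lemma constant_on_interval:
  fixes h :: "real \<Rightarrow> complex"
  assumes "\<And>x. x \<in> {0..b} \<Longrightarrow> (h has_vector_derivative 0) (at x within {0..b})" "x \<in> {0..b}"
  shows "h x = h 0"
  using has_vector_derivative_zero_constant[of "{0..b}" h] assms b by (metis atLeastAtMost_iff convex_closed_interval order_refl)

text \<open>The sign \<open>\<sigma>\<close> is \<open>-1\<close> for \<open>X\<^sup>(\<^sup>n\<^sup>)\<close>, \<open>Y\<^sup>(\<^sup>n\<^sup>)\<close> and \<open>1\<close> for the functions with a tilde.\<close>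

context
  fixes X0 Y0 :: "real \<Rightarrow> complex" and \<sigma> :: complex
  assumes X0: "\<And>x. x \<in> {0..b} \<Longrightarrow> (X0 has_vector_derivative \<sigma> * (p x / (f x)\<^sup>2)) (at x within {0..b})"
    and Y0: "\<And>x. x \<in> {0..b} \<Longrightarrow> (Y0 has_vector_derivative - \<sigma> * (p x / (g x)\<^sup>2)) (at x within {0..b})"
    and XY0: "X0 0 - Y0 0 = \<sigma>"
begin

abbreviation "X \<equiv> xrec p f g X0 Y0"
abbreviation "Y \<equiv> yrec p f g X0 Y0"
abbreviation "Z n \<equiv> zfun f g (X n) (Y n)"

lemma zfun_derivative:
  assumes "continuous_on {0..b} (X n)" "continuous_on {0..b} (Y n)" "x \<in> {0..b}"
  shows "(Z n has_vector_derivative (f x)\<^sup>2 * X n x + (g x)\<^sup>2 * Y n x) (at x within {0..b})"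
  unfolding zfun_def
  by (rule integral_has_vector_derivative) (use assms continuous_fg in \<open>auto intro!: continuous_intros\<close>)

lemma rec_derivative:
  assumes "continuous_on {0..b} (X n)" "continuous_on {0..b} (Y n)" and x: "x \<in> {0..b}"
  shows "(X (Suc n) has_vector_derivative
      - of_nat (n + 1) * (p x / (f x)\<^sup>2 * Z n x + g x / f x * Y n x)) (at x within {0..b})"
    and "(Y (Suc n) has_vector_derivative
      of_nat (n + 1) * (p x / (g x)\<^sup>2 * Z n x + f x / g x * X n x)) (at x within {0..b})"
proof -
  have "continuous_on {0..b} (Z n)"
    by (rule continuous_on_vector_derivative[OF zfun_derivative[OF assms(1,2)]])
  then have "continuous_on {0..b} (\<lambda>x. p x / (f x)\<^sup>2 * Z n x + g x / f x * Y n x)"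
    "continuous_on {0..b} (\<lambda>x. p x / (g x)\<^sup>2 * Z n x + f x / g x * X n x)"
    using assms p continuous_fg nz by (auto intro!: continuous_intros)
  note int = this[THEN integral_has_vector_derivative, OF x]
  show "(X (Suc n) has_vector_derivative
      - of_nat (n + 1) * (p x / (f x)\<^sup>2 * Z n x + g x / f x * Y n x)) (at x within {0..b})"
    "(Y (Suc n) has_vector_derivative
      of_nat (n + 1) * (p x / (g x)\<^sup>2 * Z n x + f x / g x * X n x)) (at x within {0..b})"
    unfolding xrec.simps yrec.simps
    by (intro has_vector_derivative_mult_right int)+
qed

lemma continuous_rec: "continuous_on {0..b} (X n)" "continuous_on {0..b} (Y n)"
proof (induction n)
  case 0
  show "continuous_on {0..b} (X 0)" "continuous_on {0..b} (Y 0)"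
    unfolding xrec.simps yrec.simps
    by (rule continuous_on_vector_derivative[OF X0] continuous_on_vector_derivative[OF Y0], assumption)+
next
  case (Suc n)
  show "continuous_on {0..b} (X (Suc n))" "continuous_on {0..b} (Y (Suc n))"
    by (rule continuous_on_vector_derivative, rule rec_derivative[OF Suc], assumption)+
qed

text \<open>Both sides have the derivative \<sigma> (p/f^2 + p/g^2), and they agree at 0 because of
  \<open>init\<close>.\<close>

lemma rec_difference_0:
  assumes x: "x \<in> {0..b}"
  shows "X0 x - Y0 x = \<sigma> / (f x * g x)"
proof -
  have "X0 x - Y0 x - \<sigma> * inverse (f x * g x) = X0 0 - Y0 0 - \<sigma> * inverse (f 0 * g 0)"
  proof (rule constant_on_interval[OF _ x])
    fix x assume x: "x \<in> {0..b}"
    have "((\<lambda>x. X0 x - Y0 x - \<sigma> * inverse (f x * g x)) has_vector_derivative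
      \<sigma> * (p x / (f x)\<^sup>2) - - \<sigma> * (p x / (g x)\<^sup>2) - \<sigma> * (p x * ((f x)\<^sup>2 + (g x)\<^sup>2) / (f x * g x)\<^sup>2))
      (at x within {0..b})"
      by (intro has_vector_derivative_diff has_vector_derivative_mult_right X0 Y0 has_vector_derivative_inverse_fg x)
    moreover have "\<sigma> * (p x / (f x)\<^sup>2) - - \<sigma> * (p x / (g x)\<^sup>2) - \<sigma> * (p x * ((f x)\<^sup>2 + (g x)\<^sup>2) / (f x * g x)\<^sup>2) = 0"
      using nz[OF x] by (simp add: field_simps)
    ultimately show "((\<lambda>x. X0 x - Y0 x - \<sigma> * inverse (f x * g x)) has_vector_derivative 0) (at x within {0..b})"
      by simp
  qed
  then show ?thesis using XY0 init by (simp add: divide_inverse)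
qed

text \<open>In the derivative of Z/(f g), the factor 1/(f g) gives the terms p/f^2 Z + p/g^2 Z, and
  the derivative of Z gives (f/g) X + (g/f) Y. These are the integrands of the two recurrences, and
  everything vanishes at 0.\<close>

lemma rec_difference_Suc:
  assumes x: "x \<in> {0..b}"
  shows "X (Suc n) x - Y (Suc n) x = - of_nat (n + 1) * (Z n x / (f x * g x))"
proof -
  define c where "c = (of_nat (n + 1) :: complex)"
  define D where "D x = X (Suc n) x - Y (Suc n) x + c * (Z n x * inverse (f x * g x))" for x
  have "D x = D 0"
  proof (rule constant_on_interval[OF _ x])
    fix x assume x: "x \<in> {0..b}"
    have "(D has_vector_derivative
        - c * (p x / (f x)\<^sup>2 * Z n x + g x / f x * Y n x)
        - c * (p x / (g x)\<^sup>2 * Z n x + f x / g x * X n x)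
        + c * (Z n x * (p x * ((f x)\<^sup>2 + (g x)\<^sup>2) / (f x * g x)\<^sup>2)
            + ((f x)\<^sup>2 * X n x + (g x)\<^sup>2 * Y n x) * inverse (f x * g x))) (at x within {0..b})"
      unfolding D_def c_def
      by (intro has_vector_derivative_add has_vector_derivative_diff has_vector_derivative_mult_right
          has_vector_derivative_mult rec_derivative zfun_derivative continuous_rec has_vector_derivative_inverse_fg x)
    moreover have "- c * (p x / (f x)\<^sup>2 * Z n x + g x / f x * Y n x)
        - c * (p x / (g x)\<^sup>2 * Z n x + f x / g x * X n x)
        + c * (Z n x * (p x * ((f x)\<^sup>2 + (g x)\<^sup>2) / (f x * g x)\<^sup>2)
            + ((f x)\<^sup>2 * X n x + (g x)\<^sup>2 * Y n x) * inverse (f x * g x)) = 0"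
      using nz[OF x] by (simp add: field_simps power2_eq_square)
    ultimately show "(D has_vector_derivative 0) (at x within {0..b})" by (simp only:)
  qed
  moreover have "D 0 = 0" by (simp add: D_def zfun_def)
  ultimately have "X (Suc n) x - Y (Suc n) x + c * (Z n x / (f x * g x)) = 0"
    by (simp only: D_def divide_inverse)
  then show ?thesis by (simp only: c_def eq_neg_iff_add_eq_0 mult_minus_left)
qed

text \<open>The closed form of X - Y rewrites the recurrence term with Z as p g (X - Y). Its part
  with X cancels against the product rule and - p g Y stays; the second component is analogous. So
  (f X, g Y) solves the system of (f, g) with the preceding power as inhomogeneity. For
  \<open>n = 0\<close> the initial \<sigma> term replaces the one with Z.\<close>

lemma formal_power_derivative:
  assumes x: "x \<in> {0..b}"
  shows "((\<lambda>x. f x * X n x) has_vector_derivative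
      q x * (f x * X n x) - p x * (g x * Y n x) - of_nat n * (g x * Y (n - 1) x)) (at x within {0..b})"
    and "((\<lambda>x. g x * Y n x) has_vector_derivative
      - p x * (f x * X n x) - q x * (g x * Y n x) + of_nat n * (f x * X (n - 1) x)) (at x within {0..b})"
proof -
  have fg: "f x \<noteq> 0" "g x \<noteq> 0" using nz x by auto
  show "((\<lambda>x. f x * X n x) has_vector_derivative
      q x * (f x * X n x) - p x * (g x * Y n x) - of_nat n * (g x * Y (n - 1) x)) (at x within {0..b})"
  proof (cases n)
    case 0
    have eq: "X0 x = Y0 x + \<sigma> / (f x * g x)" using rec_difference_0[OF x] by (simp add: algebra_simps)
    have "f x * (\<sigma> * (p x / (f x)\<^sup>2)) + (q x * f x - p x * g x) * X0 x = q x * (f x * X0 x) - p x * (g x * Y0 x)"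
      unfolding eq using fg by (simp add: field_simps power2_eq_square)
    then show ?thesis
      using has_vector_derivative_mult[OF f[OF x] X0[OF x]] 0 by simp
  next
    case (Suc m)
    define c where "c = (of_nat (m + 1) :: complex)"
    \<comment> \<open>Eliminating \<open>X n\<close> leaves a rational identity in which the
      remaining quantities are free.\<close>
    have eq: "X n x = Y n x - c * (Z m x / (f x * g x))"
      using rec_difference_Suc[OF x, of m, folded c_def] unfolding Suc
      by (simp del: xrec.simps yrec.simps add: diff_eq_eq)
    have "f x * (- c * (p x / (f x)\<^sup>2 * Z m x + g x / f x * Y m x)) + (q x * f x - p x * g x) * X n x
        = q x * (f x * X n x) - p x * (g x * Y n x) - c * (g x * Y m x)"
      unfolding eq using fg by (simp add: field_simps power2_eq_square)
    then show ?thesis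
      using has_vector_derivative_mult[OF f[OF x] rec_derivative(1)[OF continuous_rec x, of m]]
      unfolding c_def Suc by (simp del: xrec.simps yrec.simps)
  qed
  show "((\<lambda>x. g x * Y n x) has_vector_derivative
      - p x * (f x * X n x) - q x * (g x * Y n x) + of_nat n * (f x * X (n - 1) x)) (at x within {0..b})"
  proof (cases n)
    case 0
    have eq: "Y0 x = X0 x - \<sigma> / (f x * g x)" using rec_difference_0[OF x] by (simp add: algebra_simps)
    have "g x * (- \<sigma> * (p x / (g x)\<^sup>2)) + (- p x * f x - q x * g x) * Y0 x = - p x * (f x * X0 x) - q x * (g x * Y0 x)"
      unfolding eq using fg by (simp add: field_simps power2_eq_square)
    then show ?thesis
      using has_vector_derivative_mult[OF g[OF x] Y0[OF x]] 0 by simp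
  next
    case (Suc m)
    define c where "c = (of_nat (m + 1) :: complex)"
    have eq: "Y n x = X n x + c * (Z m x / (f x * g x))"
      using rec_difference_Suc[OF x, of m, folded c_def] unfolding Suc
      by (simp del: xrec.simps yrec.simps add: diff_eq_eq)
    have "g x * (c * (p x / (g x)\<^sup>2 * Z m x + f x / g x * X m x)) + (- p x * f x - q x * g x) * Y n x
        = - p x * (f x * X n x) - q x * (g x * Y n x) + c * (f x * X m x)"
      unfolding eq using fg by (simp add: field_simps power2_eq_square)
    then show ?thesis
      using has_vector_derivative_mult[OF g[OF x] rec_derivative(2)[OF continuous_rec x, of m]]
      unfolding c_def Suc by (simp del: xrec.simps yrec.simps)
  qed
qed

end

end

subsection \<open>Wave matrices and the approximation\<close>

lemma (in dirac_solution) Xpow_Ypow_derivative: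
  assumes "x \<in> {0..b}"
  shows "((\<lambda>x. f x * Xpow p f g n x) has_vector_derivative q x * (f x * Xpow p f g n x)
      - p x * (g x * Ypow p f g n x) - of_nat n * (g x * Ypow p f g (n - 1) x)) (at x within {0..b})"
    and "((\<lambda>x. g x * Ypow p f g n x) has_vector_derivative - p x * (f x * Xpow p f g n x)
      - q x * (g x * Ypow p f g n x) + of_nat n * (f x * Xpow p f g (n - 1) x)) (at x within {0..b})"
proof -
  have cont: "continuous_on {0..b} (\<lambda>x. p x / (f x)\<^sup>2)" "continuous_on {0..b} (\<lambda>x. p x / (g x)\<^sup>2)"
    using p continuous_fg nz by (auto intro!: continuous_intros)
  note int = cont[THEN integral_has_vector_derivative]
  \<comment> \<open>The factor \<open>- 1\<close> is left visible so that unification reads off the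
    value of \<sigma>.\<close>
  have X0: "((\<lambda>x. - integral {0..x} (\<lambda>s. p s / (f s)\<^sup>2)) has_vector_derivative - 1 * (p x / (f x)\<^sup>2)) (at x within {0..b})"
    if "x \<in> {0..b}" for x
    using has_vector_derivative_minus[OF int(1)[OF that]] by simp
  have Y0: "((\<lambda>x. 1 + integral {0..x} (\<lambda>s. p s / (g s)\<^sup>2)) has_vector_derivative - (- 1) * (p x / (g x)\<^sup>2)) (at x within {0..b})"
    if "x \<in> {0..b}" for x
    using has_vector_derivative_add[OF has_vector_derivative_const int(2)[OF that]] by simp
  from formal_power_derivative[OF X0 Y0 _ assms]
  show "((\<lambda>x. f x * Xpow p f g n x) has_vector_derivative q x * (f x * Xpow p f g n x)
      - p x * (g x * Ypow p f g n x) - of_nat n * (g x * Ypow p f g (n - 1) x)) (at x within {0..b})"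
    "((\<lambda>x. g x * Ypow p f g n x) has_vector_derivative - p x * (f x * Xpow p f g n x)
      - q x * (g x * Ypow p f g n x) + of_nat n * (f x * Xpow p f g (n - 1) x)) (at x within {0..b})"
    unfolding Xpow_def Ypow_def by simp_all
qed

lemma (in dirac_solution) Xpow_tilde_Ypow_tilde_derivative:
  assumes "x \<in> {0..b}"
  shows "((\<lambda>x. f x * Xpow_tilde p f g n x) has_vector_derivative q x * (f x * Xpow_tilde p f g n x)
      - p x * (g x * Ypow_tilde p f g n x) - of_nat n * (g x * Ypow_tilde p f g (n - 1) x)) (at x within {0..b})"
    and "((\<lambda>x. g x * Ypow_tilde p f g n x) has_vector_derivative - p x * (f x * Xpow_tilde p f g n x)
      - q x * (g x * Ypow_tilde p f g n x) + of_nat n * (f x * Xpow_tilde p f g (n - 1) x)) (at x within {0..b})"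
proof -
  have cont: "continuous_on {0..b} (\<lambda>x. p x / (f x)\<^sup>2)" "continuous_on {0..b} (\<lambda>x. p x / (g x)\<^sup>2)"
    using p continuous_fg nz by (auto intro!: continuous_intros)
  note int = cont[THEN integral_has_vector_derivative]
  have X0: "((\<lambda>x. 1 + integral {0..x} (\<lambda>s. p s / (f s)\<^sup>2)) has_vector_derivative 1 * (p x / (f x)\<^sup>2)) (at x within {0..b})"
    if "x \<in> {0..b}" for x
    using has_vector_derivative_add[OF has_vector_derivative_const int(1)[OF that]] by simp
  have Y0: "((\<lambda>x. - integral {0..x} (\<lambda>s. p s / (g s)\<^sup>2)) has_vector_derivative - 1 * (p x / (g x)\<^sup>2)) (at x within {0..b})"
    if "x \<in> {0..b}" for x
    using has_vector_derivative_minus[OF int(2)[OF that]] by simp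
  from formal_power_derivative[OF X0 Y0 _ assms]
  show "((\<lambda>x. f x * Xpow_tilde p f g n x) has_vector_derivative q x * (f x * Xpow_tilde p f g n x)
      - p x * (g x * Ypow_tilde p f g n x) - of_nat n * (g x * Ypow_tilde p f g (n - 1) x)) (at x within {0..b})"
    "((\<lambda>x. g x * Ypow_tilde p f g n x) has_vector_derivative - p x * (f x * Xpow_tilde p f g n x)
      - q x * (g x * Ypow_tilde p f g n x) + of_nat n * (f x * Xpow_tilde p f g (n - 1) x)) (at x within {0..b})"
    unfolding Xpow_tilde_def Ypow_tilde_def by simp_all
qed

text \<open>
  The components of \<open>B \<phi>\<^sub>n' + Q \<phi>\<^sub>n = - n \<psi>\<^sub>n\<^sub>-\<^sub>1\<close> and \<open>B \<psi>\<^sub>n' + Q \<psi>\<^sub>n = n \<phi>\<^sub>n\<^sub>-\<^sub>1\<close>; for \<open>n = 0\<close> the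
  factor \<open>n\<close> makes the truncated index harmless.
\<close>

definition conjugate_powers ::
  "real \<Rightarrow> (real \<Rightarrow> complex) \<Rightarrow> (real \<Rightarrow> complex) \<Rightarrow> (nat \<Rightarrow> real \<Rightarrow> complex^2) \<Rightarrow> (nat \<Rightarrow> real \<Rightarrow> complex^2) \<Rightarrow> bool" where
  "conjugate_powers b p q \<phi> \<psi> \<longleftrightarrow> (\<forall>n. \<forall>x\<in>{0..b}.
     ((\<lambda>x. \<phi> n x $ 1) has_vector_derivative q x * \<phi> n x $ 1 - p x * \<phi> n x $ 2 + of_nat n * \<psi> (n - 1) x $ 2) (at x within {0..b}) \<and>
     ((\<lambda>x. \<phi> n x $ 2) has_vector_derivative - p x * \<phi> n x $ 1 - q x * \<phi> n x $ 2 - of_nat n * \<psi> (n - 1) x $ 1) (at x within {0..b}) \<and>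
     ((\<lambda>x. \<psi> n x $ 1) has_vector_derivative q x * \<psi> n x $ 1 - p x * \<psi> n x $ 2 - of_nat n * \<phi> (n - 1) x $ 2) (at x within {0..b}) \<and>
     ((\<lambda>x. \<psi> n x $ 2) has_vector_derivative - p x * \<psi> n x $ 1 - q x * \<psi> n x $ 2 + of_nat n * \<phi> (n - 1) x $ 1) (at x within {0..b}))"

text \<open>The relations are invariant under the rotation (\<phi>, \<psi>) -> (\<psi>, -\<phi>), so
  one result on pairs of columns covers both \<open>O1\<close> and \<open>O3\<close>.\<close>

lemma conjugate_powers_swap:
  assumes "conjugate_powers b p q \<phi> \<psi>"
  shows "conjugate_powers b p q \<psi> (\<lambda>n x. - \<phi> n x)"
  unfolding conjugate_powers_def
proof (intro allI ballI conjI)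
  fix n x assume x: "x \<in> {0..b}"
  note h = assms[unfolded conjugate_powers_def, rule_format, OF x, of n]
  show "((\<lambda>x. \<psi> n x $ 1) has_vector_derivative q x * \<psi> n x $ 1 - p x * \<psi> n x $ 2 + of_nat n * (- \<phi> (n - 1) x) $ 2) (at x within {0..b})"
    "((\<lambda>x. \<psi> n x $ 2) has_vector_derivative - p x * \<psi> n x $ 1 - q x * \<psi> n x $ 2 - of_nat n * (- \<phi> (n - 1) x) $ 1) (at x within {0..b})"
    using h by simp_all
  show "((\<lambda>x. (- \<phi> n x) $ 1) has_vector_derivative q x * (- \<phi> n x) $ 1 - p x * (- \<phi> n x) $ 2 - of_nat n * \<psi> (n - 1) x $ 2) (at x within {0..b})"
    using has_vector_derivative_minus[OF h[THEN conjunct1]] by (simp add: algebra_simps)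
  show "((\<lambda>x. (- \<phi> n x) $ 2) has_vector_derivative - p x * (- \<phi> n x) $ 1 - q x * (- \<phi> n x) $ 2 + of_nat n * \<psi> (n - 1) x $ 1) (at x within {0..b})"
    using has_vector_derivative_minus[OF h[THEN conjunct2, THEN conjunct1]] by (simp add: algebra_simps)
qed

text \<open>For n > 0, \<open>Phi n\<close> and \<open>Psi (n - 1)\<close> come from the same
  family, with or without tilde, and carry opposite signs; \<open>Psi n\<close> and
  \<open>Phi (n - 1)\<close> come from the same family with equal signs. This turns the derivatives
  of the formal powers into the two conjugate relations.\<close>

lemma (in dirac_solution) conjugate_powers_Phi_Psi:
  "conjugate_powers b p q (Phi p f g) (Psi p f g)"
  unfolding conjugate_powers_def
proof (intro allI ballI)
  fix n x assume x: "x \<in> {0..b}"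
  note d = Xpow_Ypow_derivative[OF x, of n] Xpow_tilde_Ypow_tilde_derivative[OF x, of n]
  note dc = d[THEN has_vector_derivative_mult_right]
  show "((\<lambda>x. Phi p f g n x $ 1) has_vector_derivative q x * Phi p f g n x $ 1 - p x * Phi p f g n x $ 2 + of_nat n * Psi p f g (n - 1) x $ 2) (at x within {0..b}) \<and>
     ((\<lambda>x. Phi p f g n x $ 2) has_vector_derivative - p x * Phi p f g n x $ 1 - q x * Phi p f g n x $ 2 - of_nat n * Psi p f g (n - 1) x $ 1) (at x within {0..b}) \<and>
     ((\<lambda>x. Psi p f g n x $ 1) has_vector_derivative q x * Psi p f g n x $ 1 - p x * Psi p f g n x $ 2 - of_nat n * Phi p f g (n - 1) x $ 2) (at x within {0..b}) \<and>
     ((\<lambda>x. Psi p f g n x $ 2) has_vector_derivative - p x * Psi p f g n x $ 1 - q x * Psi p f g n x $ 2 + of_nat n * Phi p f g (n - 1) x $ 1) (at x within {0..b})"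
  proof (cases "even n")
    case True
    show ?thesis
    \<comment> \<open>The parity of \<open>n - 1\<close> is opposite to that of \<open>n\<close>
      only when \<open>n > 0\<close>; for \<open>n = 0\<close> the last term carries the factor
      0.\<close>
    proof (cases n)
      case 0
      show ?thesis
        using dc(1,2)[where a = "f 0"] dc(3,4)[where a = "g 0"] unfolding 0 Phi_def Psi_def
        by (simp add: algebra_simps)
    next
      case (Suc m)
      then obtain k where k: "m = 2 * k + 1" using True by (auto elim!: oddE)
      then show ?thesis
        using dc(1,2)[where a = "(- 1) ^ (n div 2) * f 0"] dc(3,4)[where a = "(- 1) ^ (n div 2) * g 0"]
        unfolding Phi_def Psi_def Suc k by (simp add: algebra_simps del: of_nat_add of_nat_Suc)
    qed
  next
    case False
    then obtain k where "n = 2 * k + 1" by (auto elim!: oddE)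
    then show ?thesis
      using dc(1,2)[where a = "(- 1) ^ ((n + 1) div 2) * f 0"] dc(3,4)[where a = "(- 1) ^ ((n - 1) div 2) * g 0"]
      unfolding Phi_def Psi_def by (simp add: algebra_simps del: of_nat_add of_nat_Suc)
  qed
qed

text \<open>Even powers of \<open>t\<close> fill the first column and odd powers the second. Since A
  -> BAB moves one column to the other, the conjugate relations are the derivative condition of
  \<open>char_solution_binomial_family\<close>.\<close>

lemma char_solution_conjugate_powers:
  assumes "conjugate_powers b p q \<phi> \<psi>"
  shows "char_solution b (potential p q) (\<lambda>x t. cols2
    (\<Sum>k | k \<le> m \<and> even k. (of_nat (m choose k) * of_real t ^ k) *s \<phi> (m - k) x)
    (- (\<Sum>k | k \<le> m \<and> odd k. (of_nat (m choose k) * of_real t ^ k) *s \<psi> (m - k) x)))"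
proof -
  define G where "G n k x = (if even k then matrix2 (\<phi> n x $ 1) 0 (\<phi> n x $ 2) 0
     else matrix2 0 (- (\<psi> n x $ 1)) 0 (- (\<psi> n x $ 2)))" for n k :: nat and x
  have "char_solution b (potential p q) (\<lambda>x t. \<Sum>k\<le>m. (real (m choose k) * t ^ k) *\<^sub>R G (m - k) k x)"
  proof (rule char_solution_binomial_family)
    fix n k x assume "x \<in> {0..b}"
    note h = assms[unfolded conjugate_powers_def, rule_format, OF this, of n]
    show "(G n k has_vector_derivative matB ** potential p q x ** G n k x
      + real n *\<^sub>R (matB ** G (n - 1) (Suc k) x ** matB)) (at x within {0..b})"
    proof (cases "even k")
      case True
      have "matB ** potential p q x ** G n k x + real n *\<^sub>R (matB ** G (n - 1) (Suc k) x ** matB)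
        = matrix2 (q x * \<phi> n x $ 1 - p x * \<phi> n x $ 2 + of_nat n * \<psi> (n - 1) x $ 2) 0
            (- p x * \<phi> n x $ 1 - q x * \<phi> n x $ 2 - of_nat n * \<psi> (n - 1) x $ 1) 0"
        using True by (simp add: G_def matrix2_arith)
      moreover have "G n k = (\<lambda>x. matrix2 (\<phi> n x $ 1) 0 (\<phi> n x $ 2) 0)"
        using True by (simp add: G_def fun_eq_iff)
      ultimately show ?thesis
        using h by (auto intro!: has_vector_derivative_matrix2)
    next
      case False
      have "matB ** potential p q x ** G n k x + real n *\<^sub>R (matB ** G (n - 1) (Suc k) x ** matB)
        = matrix2 0 (- (q x * \<psi> n x $ 1 - p x * \<psi> n x $ 2 - of_nat n * \<phi> (n - 1) x $ 2))
            0 (- (- p x * \<psi> n x $ 1 - q x * \<psi> n x $ 2 + of_nat n * \<phi> (n - 1) x $ 1))"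
        using False by (simp add: G_def matrix2_arith)
      moreover have "G n k = (\<lambda>x. matrix2 0 (- (\<psi> n x $ 1)) 0 (- (\<psi> n x $ 2)))"
        using False by (simp add: G_def fun_eq_iff)
      ultimately show ?thesis
        using h by (simp only:) (intro has_vector_derivative_matrix2 has_vector_derivative_minus has_vector_derivative_const; simp)
    qed
  qed
  moreover have "(\<lambda>x t. \<Sum>k\<le>m. (real (m choose k) * t ^ k) *\<^sub>R G (m - k) k x) = (\<lambda>x t. cols2
    (\<Sum>k | k \<le> m \<and> even k. (of_nat (m choose k) * of_real t ^ k) *s \<phi> (m - k) x)
    (- (\<Sum>k | k \<le> m \<and> odd k. (of_nat (m choose k) * of_real t ^ k) *s \<psi> (m - k) x)))"
  proof (intro ext)
    fix x t
    \<comment> \<open>Sums restricted by parity become full sums padded with zeros, so that both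
      sides can be compared term by term.\<close>
    have split: "(\<Sum>k\<in>{k. k \<le> m \<and> P k}. h k) = (\<Sum>k\<le>m. if P k then h k else 0)" for P and h :: "nat \<Rightarrow> complex"
      by (subst sum.inter_filter[symmetric]) (auto intro!: sum.cong)
    show "(\<Sum>k\<le>m. (real (m choose k) * t ^ k) *\<^sub>R G (m - k) k x) = cols2
      (\<Sum>k | k \<le> m \<and> even k. (of_nat (m choose k) * of_real t ^ k) *s \<phi> (m - k) x)
      (- (\<Sum>k | k \<le> m \<and> odd k. (of_nat (m choose k) * of_real t ^ k) *s \<psi> (m - k) x))"
      unfolding cols2_eq_matrix2
      by (simp add: vec_eq_iff forall_2 matrix2_vec_nth split sum_negf[symmetric] G_def)
         (auto intro!: sum.cong simp: matrix2_vec_nth scaleR_complex)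
  qed
  ultimately show ?thesis by simp
qed

text \<open>\<open>O1\<close> belongs to the pair (Phi, Psi) and \<open>O3\<close> to the rotated
  pair (Psi, -Phi); \<open>O2\<close> and \<open>O4\<close> arise from them by right multiplication
  with \<open>matB\<close>.\<close>

lemma (in dirac_solution) char_solution_approx_kernel:
  "char_solution b (potential p q) (approx_kernel p f g N \<alpha> \<beta> \<gamma> \<delta>)"
proof -
  have O1: "char_solution b (potential p q) (O1 p f g m)" for m
    using char_solution_conjugate_powers[OF conjugate_powers_Phi_Psi, of m]
    unfolding O1_def[abs_def] U_lo_def V_hi_def .
  have O3: "char_solution b (potential p q) (O3 p f g m)" for m
    using char_solution_conjugate_powers[OF conjugate_powers_swap[OF conjugate_powers_Phi_Psi], of m]
    unfolding O3_def[abs_def] V_lo_def U_hi_def by (simp add: vector_sneg_minus1[symmetric] sum_negf vector_smult_rneg)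
  have O2: "char_solution b (potential p q) (O2 p f g m)" for m
    using char_solution_mult_matB[OF O1, of m]
    unfolding O1_def O2_def[abs_def] cols2_eq_matrix2 matB_def matrix2_mult by simp
  have O4: "char_solution b (potential p q) (O4 p f g m)" for m
    using char_solution_mult_matB[OF O3, of m]
    unfolding O3_def O4_def[abs_def] cols2_eq_matrix2 matB_def matrix2_mult by simp
  show ?thesis
    unfolding approx_kernel_def[abs_def]
    by (intro char_solution_sum char_solution_add char_solution_cscale O1 O2 O3 O4)
qed

section \<open>Boundary values of the approximating kernel\<close>

lemma U_V_reflect:
  "U_lo p f g m x (- t) = U_lo p f g m x t" "U_hi p f g m x (- t) = - U_hi p f g m x t"
  "V_lo p f g m x (- t) = V_lo p f g m x t" "V_hi p f g m x (- t) = - V_hi p f g m x t"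
  unfolding U_lo_def U_hi_def V_lo_def V_hi_def sum_negf[symmetric]
  by (auto intro!: sum.cong simp: power_minus_even power_minus_odd vector_smult_lneg)

text \<open>This holds for each summand as an algebraic identity, with the wave vectors as free
  quantities. \<open>trace_matrix\<close> is built so that its products encode the
  \<open>Pplus\<close> boundary data on t = x and, in the complementary component, the
  \<open>Pminus\<close> data on t = -x. One matrix approximation therefore controls both
  edges.\<close>

lemma Pplus_approx_kernel_diagonal:
  "Pplus (approx_kernel p f g N \<alpha> \<beta> \<gamma> \<delta> x x) =
    - (matB ** Pplus (\<Sum>n=0..N. trace_matrix p f g n x ** matrix2 (\<alpha> n) (\<beta> n) (\<gamma> n) (\<delta> n)))"
  unfolding approx_kernel_def linear_sum[OF linear_Pplus] mat2.sum_right sum_negf[symmetric]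
proof (rule sum.cong[OF refl])
  fix n
  show "Pplus (cscale (\<alpha> n) (O1 p f g n x x) + cscale (\<beta> n) (O2 p f g n x x)
      + cscale (\<gamma> n) (O3 p f g n x x) + cscale (\<delta> n) (O4 p f g n x x))
    = - (matB ** Pplus (trace_matrix p f g n x ** matrix2 (\<alpha> n) (\<beta> n) (\<gamma> n) (\<delta> n)))"
    unfolding O1_def O2_def O3_def O4_def trace_matrix_def cols2_eq_matrix2
    by (simp add: matrix2_arith matrix_vector_mult_def sum_2 matrix2_vec_nth field_simps)
qed

text \<open>Parity in \<open>t\<close> expresses the values at t = -x through those at t = x, which
  are the ones that \<open>trace_matrix\<close> contains.\<close>

lemma Pminus_approx_kernel_antidiagonal:
  "Pminus (approx_kernel p f g N \<alpha> \<beta> \<gamma> \<delta> x (- x)) =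
    - (matB ** Pminus (\<Sum>n=0..N. trace_matrix p f g n x ** matrix2 (\<alpha> n) (\<beta> n) (\<gamma> n) (\<delta> n)))"
  unfolding approx_kernel_def linear_sum[OF linear_Pminus] mat2.sum_right sum_negf[symmetric]
proof (rule sum.cong[OF refl])
  fix n
  show "Pminus (cscale (\<alpha> n) (O1 p f g n x (- x)) + cscale (\<beta> n) (O2 p f g n x (- x))
      + cscale (\<gamma> n) (O3 p f g n x (- x)) + cscale (\<delta> n) (O4 p f g n x (- x)))
    = - (matB ** Pminus (trace_matrix p f g n x ** matrix2 (\<alpha> n) (\<beta> n) (\<gamma> n) (\<delta> n)))"
    unfolding O1_def O2_def O3_def O4_def trace_matrix_def cols2_eq_matrix2 U_V_reflect
    by (simp add: matrix2_arith matrix_vector_mult_def sum_2 matrix2_vec_nth field_simps)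
qed

text \<open>The order of the quantifiers makes \<open>C\<close> independent of the solution (f, g)
  and of the coefficients as well as of \<open>N\<close>. Boundedness is part of the conclusion
  because \<open>SUP\<close> on the reals is a genuine supremum only for a set bounded
  above.\<close>

theorem theorem5p4:
  fixes b :: real and p q :: "real \<Rightarrow> complex"
  assumes "b > 0"
    and "continuous_on {0..b} (potential p q)"
  shows "\<exists>C::real. \<forall>K f g (N::nat) \<alpha> \<beta> \<gamma> \<delta> (\<epsilon>::real).
    integral_kernel b (potential p q) K \<longrightarrow>
    admissible_solution b p q f g \<longrightarrow>
    (\<forall>x\<in>{0..b}. norm (- (1 / 2) *\<^sub>R potential p q x
        - (\<Sum>n=0..N. trace_matrix p f g n x ** matrix2 (\<alpha> n) (\<beta> n) (\<gamma> n) (\<delta> n))) < \<epsilon>) \<longrightarrow>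
    bdd_above ((\<lambda>(x, t). norm (K x t - approx_kernel p f g N \<alpha> \<beta> \<gamma> \<delta> x t)) ` Omega b) \<and>
    (SUP (x, t)\<in>Omega b. norm (K x t - approx_kernel p f g N \<alpha> \<beta> \<gamma> \<delta> x t)) < C * \<epsilon>"
proof (rule kernel_stability[OF assms(2)])
  fix C :: real
  assume stable: "\<And>K W r x t. integral_kernel b (potential p q) K \<Longrightarrow>
    char_solution b (potential p q) W \<Longrightarrow> 0 \<le> r \<Longrightarrow>
    (\<And>x. x \<in> {0..b} \<Longrightarrow> norm ((1 / 2) *\<^sub>R (matB ** potential p q x) - Pplus (W x x)) \<le> r) \<Longrightarrow>
    (\<And>x. x \<in> {0..b} \<Longrightarrow> norm (Pminus (W x (- x))) \<le> r) \<Longrightarrow>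
    (x, t) \<in> Omega b \<Longrightarrow> norm (K x t - W x t) \<le> C * r"
  \<comment> \<open>The boundary errors will be images of the trace error under these two maps;
    \<open>c\<close> is a common bound for them.\<close>
  have "bounded_linear (\<lambda>A. matB ** Pplus A)" "bounded_linear (\<lambda>A. matB ** Pminus A)"
    by (rule bounded_linear_compose[OF mat2.bounded_linear_right] bounded_linear_Pplus bounded_linear_Pminus)+
  then obtain c1 c2 where c1: "c1 > 0" "\<And>A. norm (matB ** Pplus A) \<le> norm A * c1"
    and c2: "c2 > 0" "\<And>A. norm (matB ** Pminus A) \<le> norm A * c2"
    by (metis bounded_linear.pos_bounded)
  define c where "c = max c1 c2"
  have c: "c > 0" "norm (matB ** Pplus A) \<le> c * norm A" "norm (matB ** Pminus A) \<le> c * norm A" for A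
  proof -
    have "norm A * c1 \<le> c * norm A" "norm A * c2 \<le> c * norm A"
      unfolding c_def mult.commute[of "norm A"] by (rule mult_right_mono; simp)+
    then show "c > 0" "norm (matB ** Pplus A) \<le> c * norm A" "norm (matB ** Pminus A) \<le> c * norm A"
      using c1(1) order_trans[OF c1(2)[of A]] order_trans[OF c2(2)[of A]] by (auto simp: c_def)
  qed
  show ?thesis
  \<comment> \<open>The summand 1 makes the final inequality strict, as \<epsilon> turns out to be
    positive.\<close>
  proof (intro exI[of _ "C * c + 1"] allI impI)
    fix K f g and N :: nat and \<alpha> \<beta> \<gamma> \<delta> and \<epsilon> :: real
    assume K: "integral_kernel b (potential p q) K" and fg: "admissible_solution b p q f g"
      and eps: "\<forall>x\<in>{0..b}. norm (- (1 / 2) *\<^sub>R potential p q x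
        - (\<Sum>n=0..N. trace_matrix p f g n x ** matrix2 (\<alpha> n) (\<beta> n) (\<gamma> n) (\<delta> n))) < \<epsilon>"
    interpret dirac_solution b p q f g
      using assms continuous_on_potentialD[OF assms(2)] fg admissible_solution_derivative[OF assms fg]
      by unfold_locales (auto simp: admissible_solution_def)
    define W where "W = approx_kernel p f g N \<alpha> \<beta> \<gamma> \<delta>"
    define M where "M x = (\<Sum>n=0..N. trace_matrix p f g n x ** matrix2 (\<alpha> n) (\<beta> n) (\<gamma> n) (\<delta> n))" for x
    define R where "R x = - (1 / 2) *\<^sub>R potential p q x - M x" for x
    have R: "norm (R x) < \<epsilon>" if "x \<in> {0..b}" for x
      using eps that by (simp add: R_def M_def)
    \<comment> \<open>The hypothesis at x = 0 already bounds a norm strictly by \<epsilon>.\<close>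
    have "\<epsilon> > 0" using R[of 0] assms(1) by (smt (verit) atLeastAtMost_iff norm_ge_zero)
    have bound: "norm (K x t - W x t) \<le> C * (c * \<epsilon>)" if "(x, t) \<in> Omega b" for x t
    proof (rule stable[OF K _ _ _ _ that])
      show "char_solution b (potential p q) W"
        unfolding W_def by (rule char_solution_approx_kernel)
      show "0 \<le> c * \<epsilon>" using c(1) \<open>\<epsilon> > 0\<close> by simp
      fix x assume "x \<in> {0..b}"
      then have "c * norm (R x) \<le> c * \<epsilon>" using R c(1) by (simp add: less_imp_le)
      \<comment> \<open>The datum BQ/2 is - B applied to - Q/2, just as the diagonal value of
        \<open>W\<close> is - B applied to the \<open>Pplus\<close> part of
        \<open>M\<close>.\<close>
      moreover have "(1 / 2) *\<^sub>R (matB ** potential p q x) - Pplus (W x x) = - (matB ** Pplus (R x))"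
        unfolding R_def W_def Pplus_approx_kernel_diagonal M_def[symmetric] linear_diff[OF linear_Pplus]
          linear_scale[OF linear_Pplus] Pplus_potential
        by (simp add: mat2.diff_right mat2.scaleR_right mat2.minus_right)
      ultimately show "norm ((1 / 2) *\<^sub>R (matB ** potential p q x) - Pplus (W x x)) \<le> c * \<epsilon>"
        using c(2)[of "R x"] by simp
      \<comment> \<open>\<open>Pminus\<close> annihilates the potential, so on this edge only the
        \<open>M\<close> part of \<open>R\<close> survives, with a minus sign.\<close>
      have "Pminus (W x (- x)) = matB ** Pminus (R x)"
        unfolding R_def W_def Pminus_approx_kernel_antidiagonal M_def[symmetric] linear_diff[OF linear_Pminus]
          linear_scale[OF linear_Pminus] Pminus_potential
        by (simp add: mat2.minus_right)
      then show "norm (Pminus (W x (- x))) \<le> c * \<epsilon>"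
        using c(3)[of "R x"] \<open>c * norm (R x) \<le> c * \<epsilon>\<close> by simp
    qed
    have "(0, 0) \<in> Omega b" using assms(1) by (simp add: Omega_def)
    then have "(SUP (x, t)\<in>Omega b. norm (K x t - W x t)) \<le> C * (c * \<epsilon>)"
      using bound by (intro cSUP_least) auto
    also have "\<dots> < (C * c + 1) * \<epsilon>" using \<open>\<epsilon> > 0\<close> by (simp add: algebra_simps)
    finally show "bdd_above ((\<lambda>(x, t). norm (K x t - approx_kernel p f g N \<alpha> \<beta> \<gamma> \<delta> x t)) ` Omega b) \<and>
      (SUP (x, t)\<in>Omega b. norm (K x t - approx_kernel p f g N \<alpha> \<beta> \<gamma> \<delta> x t)) < (C * c + 1) * \<epsilon>"
      using bound unfolding W_def by (auto intro!: bdd_aboveI2)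
  qed
qed

end
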